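(* For every finite tree $T$, $\operatorname{pw}(T)\le \mathcal{L}(T)\le \operatorname{pw}(T)+1$.
   Context: Lions and contamination game. Let $G=(V,E)$ be a finite graph, $N(v)$ the set of neighbours of $v$. A lion strategy with $k\ge 1$ lions consists of initial positions $p_1(0),\dots,p_k(0)\in V$ and, for each $t\ge 1$, positions $p_i(t)\in\{p_i(t-1)\}\cup N(p_i(t-1))$. Put $L_t=\{p_i(t)\}_i$, $\pi_t=\{(p_i(t-1),p_i(t))\}_i$. Contaminated sets: $W_0=V\setminus L_0$, and for $t\ge1$, $W_t=(W_{t-1}\setminus L_t)\cup\{v\in V\setminus L_t:\exists w\in W_{t-1}\cap N(v)\text{ with }(v,w)\notin\pi_t,(w,v)\notin\pi_t\}$. The strategy clears $G$ if $W_T=\emptyset$ for some $T$; $\mathcal{L}(G)$ is the minimum number of lions of a clearing strategy. Pathwidth: a path decomposition of $G$ is a sequence $(\mathcal{B}_1,\dots,\mathcal{B}_n)$ of subsets of $V$ covering $V$, such that each edge lies in some $\mathcal{B}_i$ and each vertex lies in a set of consecutive bags; its width is $\max_i|\mathcal{B}_i|-1$, and $\operatorname{pw}(G)$ is the minimum width. *)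

theory Defs
  imports "Graph_Theory.Digraph_Component"
begin

text \<open>
  A finite simple undirected graph is a \<^locale>\<open>pair_graph\<close>: finite, loop-free, and with a symmetric
  arc relation, so that an undirected edge is a pair of opposite arcs.
\<close>

definition neighbours :: "'a pair_pre_digraph \<Rightarrow> 'a \<Rightarrow> 'a set" where
  "neighbours G v = {w. (v, w) \<in> parcs G}"

text \<open>
  The library's \<^const>\<open>tree\<close> is meant for directed graphs: in a symmetric graph it counts the closed
  walk that goes along an edge and straight back as a cycle. The cycles of an undirected simple graph
  are those of length at least 3. Nonemptiness of the vertex set is part of \<^const>\<open>connected\<close>.
\<close>

definition undirected_tree :: "'a pair_pre_digraph \<Rightarrow> bool" where
  "undirected_tree G \<longleftrightarrow> pair_graph G \<and> connected (with_proj G) \<and>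
     \<not> (\<exists>c. pre_digraph.cycle (with_proj G) c \<and> 3 \<le> length c)"

text \<open>The lions are numbered \<open>0, \<dots>, k - 1\<close>, and \<open>p i t\<close> is the position of lion \<open>i\<close> at time \<open>t\<close>.\<close>

definition lion_strategy :: "'a pair_pre_digraph \<Rightarrow> nat \<Rightarrow> (nat \<Rightarrow> nat \<Rightarrow> 'a) \<Rightarrow> bool" where
  "lion_strategy G k p \<longleftrightarrow> 1 \<le> k \<and>
     (\<forall>i<k. p i 0 \<in> pverts G) \<and>
     (\<forall>i<k. \<forall>t\<ge>1. p i t \<in> {p i (t - 1)} \<union> neighbours G (p i (t - 1)))"

definition lion_positions :: "nat \<Rightarrow> (nat \<Rightarrow> nat \<Rightarrow> 'a) \<Rightarrow> nat \<Rightarrow> 'a set" where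
  "lion_positions k p t = {p i t | i. i < k}"

definition lion_moves :: "nat \<Rightarrow> (nat \<Rightarrow> nat \<Rightarrow> 'a) \<Rightarrow> nat \<Rightarrow> ('a \<times> 'a) set" where
  "lion_moves k p t = {(p i (t - 1), p i t) | i. i < k}"

primrec contaminated ::
  "'a pair_pre_digraph \<Rightarrow> nat \<Rightarrow> (nat \<Rightarrow> nat \<Rightarrow> 'a) \<Rightarrow> nat \<Rightarrow> 'a set" where
  "contaminated G k p 0 = pverts G - lion_positions k p 0"
| "contaminated G k p (Suc t) =
     (contaminated G k p t - lion_positions k p (Suc t)) \<union>
     {v \<in> pverts G - lion_positions k p (Suc t).
        \<exists>w \<in> contaminated G k p t \<inter> neighbours G v.
          (v, w) \<notin> lion_moves k p (Suc t) \<and> (w, v) \<notin> lion_moves k p (Suc t)}"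

definition clears :: "'a pair_pre_digraph \<Rightarrow> nat \<Rightarrow> (nat \<Rightarrow> nat \<Rightarrow> 'a) \<Rightarrow> bool" where
  "clears G k p \<longleftrightarrow> (\<exists>t. contaminated G k p t = {})"

definition lion_number :: "'a pair_pre_digraph \<Rightarrow> nat" where
  "lion_number G = (LEAST k. \<exists>p. lion_strategy G k p \<and> clears G k p)"

definition path_decomposition :: "'a pair_pre_digraph \<Rightarrow> 'a set list \<Rightarrow> bool" where
  "path_decomposition G Bs \<longleftrightarrow>
     (\<forall>B \<in> set Bs. B \<subseteq> pverts G) \<and>
     \<Union> (set Bs) = pverts G \<and>
     (\<forall>(u, v) \<in> parcs G. \<exists>B \<in> set Bs. u \<in> B \<and> v \<in> B) \<and>
     (\<forall>v \<in> pverts G. \<forall>i j l. i \<le> j \<and> j \<le> l \<and> l < length Bs \<and> v \<in> Bs ! i \<and> v \<in> Bs ! l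
        \<longrightarrow> v \<in> Bs ! j)"

text \<open>
  For a graph with at least one vertex some bag is nonempty, so the maximum is taken over a nonempty
  set and the subtraction does not truncate.
\<close>

definition width :: "'a set list \<Rightarrow> nat" where
  "width Bs = Max (card ` set Bs) - 1"

definition pathwidth :: "'a pair_pre_digraph \<Rightarrow> nat" where
  "pathwidth G = (LEAST w. \<exists>Bs. path_decomposition G Bs \<and> width Bs = w)"

text \<open>Both minima are attained, so that \<^const>\<open>Least\<close> is meaningful in each definition.\<close>

lemma pathwidth_attained: "\<exists>Bs. path_decomposition G Bs \<and> width Bs = pathwidth G"
  if "pair_graph G"
proof -
  interpret pair_graph G by fact
  have "path_decomposition G [pverts G]"
    by (auto simp: path_decomposition_def dest: in_arcsD1 in_arcsD2)
  then have "\<exists>w Bs. path_decomposition G Bs \<and> width Bs = w" by blast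
  then show ?thesis unfolding pathwidth_def by (rule LeastI_ex)
qed

lemma lion_number_attained: "\<exists>p. lion_strategy G (lion_number G) p \<and> clears G (lion_number G) p"
  if "pair_graph G" "pverts G \<noteq> {}"
proof -
  interpret pair_graph G by fact
  obtain f where f: "bij_betw f {0..<card (pverts G)} (pverts G)"
    using ex_bij_betw_nat_finite[OF pair_finite_verts] by blast
  let ?k = "card (pverts G)" and ?p = "\<lambda>i t. f i"
  have img: "pverts G = f ` {0..<?k}" using f by (simp add: bij_betw_def)
  have "?k \<ge> 1" using that(2) pair_finite_verts by (simp add: Suc_le_eq card_gt_0_iff)
  moreover have "lion_positions ?k ?p 0 = pverts G"
    by (subst (2) img) (auto simp: lion_positions_def)
  moreover have "\<forall>i<?k. f i \<in> pverts G"
    using f by (simp add: bij_betw_apply)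
  ultimately have "lion_strategy G ?k ?p \<and> clears G ?k ?p"
    by (auto simp: lion_strategy_def clears_def intro!: exI[of _ 0])
  then have "\<exists>k p. lion_strategy G k p \<and> clears G k p" by blast
  then show ?thesis unfolding lion_number_def by (rule LeastI_ex)
qed

end

theory Submission
  imports Defs
begin

text \<open>
  A vertex is contaminated at time \<open>t\<close> iff an evader of speed one, who knows the moves of the lions in
  advance, can reach it at time \<open>t\<close> without meeting a lion at a vertex or on an edge.

  Lower bound: by induction on \<open>k\<close>, the evader survives \<open>k\<close> lions forever on every tree of pathwidth at
  least \<open>k + 1\<close>. Such a tree has a vertex \<open>v\<close> with three branches of pathwidth at least \<open>k\<close>, and in each
  of them the evader survives \<open>k - 1\<close> lions. Call a time a mark if all lions are in a single one of the
  three branches. The evader is at \<open>v\<close> at every mark. Between two consecutive marks there is one of the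
  branches that never contains all lions, hence a safe walk \<open>x\<close> inside that branch. The evader follows
  \<open>x\<close>, but replaces \<open>x t\<close> by its ancestor (towards \<open>v\<close>) at depth \<open>D t\<close> whenever \<open>x t\<close> is deeper than
  \<open>D t\<close>, the time from \<open>t\<close> to the nearer mark. This is safe since the lions need more time
  to get from another branch to depth \<open>D t\<close>, and it starts and ends at \<open>v\<close>.

  Upper bound: lions occupy the bags of a path decomposition one after the other. Between two bags, the
  lions on their intersection stay, and separate the cleared part from the rest while the others walk.
\<close>

section \<open>Branches\<close>

text \<open>Acyclicity is stated as "every edge is a bridge", the form in which it gets used. Taken
  with \<open>u = w\<close>, the same assumption rules out loops. No vertex set is fixed, so the
  notions below apply to every subtree \<open>S\<close>.\<close>

locale acyclic_edges =
  fixes E :: "('a \<times> 'a) set"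
  assumes sym_E: "sym E"
    and bridge: "(u, w) \<in> E \<Longrightarrow> (w, u) \<notin> (E - {(u, w), (w, u)})\<^sup>*"
begin

definition conn :: "'a set \<Rightarrow> bool" where
  "conn S \<longleftrightarrow> S \<noteq> {} \<and> (\<forall>x\<in>S. \<forall>y\<in>S. (x, y) \<in> (E \<inter> S \<times> S)\<^sup>*)"

text \<open>The component of \<open>w\<close> in the subgraph induced by \<open>S - {v}\<close>.
  Reflexivity of the closure puts \<open>w\<close> into it even where \<open>w = v\<close> or
  \<open>w\<close> lies outside \<open>S\<close>.\<close>

definition branch :: "'a set \<Rightarrow> 'a \<Rightarrow> 'a \<Rightarrow> 'a set" where
  "branch S v w = {x. (w, x) \<in> (E \<inter> (S - {v}) \<times> (S - {v}))\<^sup>*}"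

lemma edge_sym: "(x, y) \<in> E \<Longrightarrow> (y, x) \<in> E"
  using sym_E by (auto dest: symD)

lemma edge_irrefl: "(x, x) \<notin> E"
  using bridge by blast

lemma sym_induced: "sym (E \<inter> X \<times> X)"
  using sym_E by (auto simp: sym_def)

lemma root_in_branch: "w \<in> branch S v w"
  by (simp add: branch_def)

lemma branch_step:
  "x \<in> branch S v w \<Longrightarrow> (x, y) \<in> E \<Longrightarrow> x \<in> S \<Longrightarrow> x \<noteq> v \<Longrightarrow> y \<in> S \<Longrightarrow> y \<noteq> v \<Longrightarrow> y \<in> branch S v w"
  unfolding branch_def by (auto intro: rtrancl_into_rtrancl)

lemma branch_least:
  assumes "w \<in> X" "\<And>x y. x \<in> X \<Longrightarrow> x \<in> S - {v} \<Longrightarrow> y \<in> S - {v} \<Longrightarrow> (x, y) \<in> E \<Longrightarrow> y \<in> X"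
  shows "branch S v w \<subseteq> X"
proof
  fix x assume "x \<in> branch S v w"
  then have "(w, x) \<in> (E \<inter> (S - {v}) \<times> (S - {v}))\<^sup>*" by (simp add: branch_def)
  then show "x \<in> X" by induction (use assms in auto)
qed

lemma branch_subset: "(v, w) \<in> E \<Longrightarrow> w \<in> S \<Longrightarrow> branch S v w \<subseteq> S - {v}"
  using edge_irrefl by (intro branch_least) auto

lemma branch_closed:
  "(v, w) \<in> E \<Longrightarrow> w \<in> S \<Longrightarrow> x \<in> branch S v w \<Longrightarrow> (x, y) \<in> E \<Longrightarrow> y \<in> S \<Longrightarrow> y \<noteq> v \<Longrightarrow> y \<in> branch S v w"
  using branch_step branch_subset by blast

text \<open>A path from \<open>w\<close> to \<open>x\<close> avoiding \<open>v\<close>, followed by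
  the edge from \<open>x\<close> to \<open>v\<close>, would bypass the bridge between
  \<open>v\<close> and \<open>w\<close>.\<close>

lemma branch_adjacent_root:
  assumes "(v, w) \<in> E" "x \<in> branch S v w" "(v, x) \<in> E"
  shows "x = w"
proof (rule ccontr)
  assume "x \<noteq> w"
  let ?R = "E - {(v, w), (w, v)}"
  have "(w, x) \<in> ?R\<^sup>*"
    using assms(2) unfolding branch_def
    by (auto elim!: rtrancl_mono[THEN subsetD, rotated])
  moreover have "(x, v) \<in> ?R" using assms(3) \<open>x \<noteq> w\<close> edge_sym edge_irrefl by auto
  ultimately have "(w, v) \<in> ?R\<^sup>*" by (rule rtrancl_into_rtrancl)
  then show False using bridge assms(1) by blast
qed

lemma branch_sym:
  "x \<in> branch S v w \<Longrightarrow> w \<in> branch S v x"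
  unfolding branch_def using sym_rtrancl[OF sym_induced] by (auto dest: symD)

lemma branch_trans:
  "x \<in> branch S v w \<Longrightarrow> y \<in> branch S v x \<Longrightarrow> y \<in> branch S v w"
  unfolding branch_def by auto

lemma branch_disjoint:
  assumes "(v, w) \<in> E" "(v, w') \<in> E" "w \<noteq> w'"
  shows "branch S v w \<inter> branch S v w' = {}"
  using assms branch_adjacent_root branch_sym branch_trans by blast

lemma conn_branch:
  assumes "(v, w) \<in> E" "w \<in> S"
  shows "conn (branch S v w)"
proof -
  let ?B = "branch S v w"
  have *: "(w, x) \<in> (E \<inter> ?B \<times> ?B)\<^sup>*" if "x \<in> ?B" for x
  proof -
    have "(w, x) \<in> (E \<inter> (S - {v}) \<times> (S - {v}))\<^sup>*" using that by (simp add: branch_def)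
    then show ?thesis
    proof induction
      case (step y z)
      then have "y \<in> ?B" "z \<in> ?B" by (auto simp: branch_def intro: rtrancl_into_rtrancl)
      then show ?case using step by (auto intro: rtrancl_into_rtrancl)
    qed auto
  qed
  have "(x, y) \<in> (E \<inter> ?B \<times> ?B)\<^sup>*" if "x \<in> ?B" "y \<in> ?B" for x y
    using *[OF that(1)] *[OF that(2)] sym_rtrancl[OF sym_induced]
    by (meson rtrancl_trans symD)
  then show ?thesis unfolding conn_def using root_in_branch by blast
qed

lemma ex_branch:
  assumes "conn S" "v \<in> S" "u \<in> S" "u \<noteq> v"
  obtains w where "w \<in> S" "(v, w) \<in> E" "u \<in> branch S v w"
proof -
  have "(v, u) \<in> (E \<inter> S \<times> S)\<^sup>*" using assms by (auto simp: conn_def)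
  then have "u = v \<or> (\<exists>w\<in>S. (v, w) \<in> E \<and> u \<in> branch S v w)"
  proof induction
    case (step y z)
    \<comment> \<open>Whenever the walk is at \<open>v\<close>, a new branch starts at its next
      vertex; otherwise the walk stays in its current branch or returns to \<open>v\<close>.\<close>
    then show ?case using root_in_branch branch_step by (metis IntE mem_Sigma_iff)
  qed auto
  then show ?thesis using assms that by blast
qed

text \<open>The only exit from \<open>branch S r h\<close> within \<open>S\<close> leads from
  \<open>h\<close> to \<open>r\<close>. A subtree that misses \<open>h\<close> cannot use it, so it
  does not grow when taken in all of \<open>S\<close>.\<close>

lemma subbranch_eq:
  assumes "(r, h) \<in> E" "h \<in> S" "u \<in> branch S r h" "w \<in> branch S r h" "(u, w) \<in> E"
    and "h \<notin> branch (branch S r h) u w"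
  shows "branch S u w = branch (branch S r h) u w"
proof
  let ?B = "branch S r h"
  show "branch S u w \<subseteq> branch ?B u w"
  proof (rule branch_least)
    fix x y assume x: "x \<in> branch ?B u w" and xy: "x \<in> S - {u}" "y \<in> S - {u}" "(x, y) \<in> E"
    have xB: "x \<in> ?B" using x branch_subset[OF assms(5,4)] by auto
    have "y \<noteq> r" using branch_adjacent_root[OF assms(1) xB] xy edge_sym assms(6) x by blast
    then have "y \<in> ?B" using branch_closed assms xB xy by blast
    then show "y \<in> branch ?B u w" using branch_step[OF x] xy xB by blast
  qed (rule root_in_branch)
  have "?B \<subseteq> S" using branch_subset assms by blast
  then show "branch ?B u w \<subseteq> branch S u w"
    unfolding branch_def[of _ u] by (auto elim!: rtrancl_mono[THEN subsetD, rotated])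
qed

section \<open>Path decompositions\<close>

text \<open>Here \<open>k\<close> bounds the bag sizes, that is, the width plus one.\<close>

definition pd :: "'a set \<Rightarrow> nat \<Rightarrow> 'a set list \<Rightarrow> bool" where
  "pd S k Bs \<longleftrightarrow> Bs \<noteq> [] \<and> \<Union> (set Bs) = S \<and> (\<forall>B\<in>set Bs. card B \<le> k) \<and>
     (\<forall>x\<in>S. \<forall>y\<in>S. (x, y) \<in> E \<longrightarrow> (\<exists>B\<in>set Bs. x \<in> B \<and> y \<in> B)) \<and>
     (\<forall>i j l. i \<le> j \<longrightarrow> j \<le> l \<longrightarrow> l < length Bs \<longrightarrow> Bs ! i \<inter> Bs ! l \<subseteq> Bs ! j)"

definition has_pd :: "'a set \<Rightarrow> nat \<Rightarrow> bool" where
  "has_pd S k \<longleftrightarrow> (\<exists>Bs. pd S k Bs)"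

lemma pdI:
  assumes "Bs \<noteq> []" "\<Union> (set Bs) = S" "\<And>B. B \<in> set Bs \<Longrightarrow> card B \<le> k"
    and "\<And>x y. x \<in> S \<Longrightarrow> y \<in> S \<Longrightarrow> (x, y) \<in> E \<Longrightarrow> \<exists>B\<in>set Bs. x \<in> B \<and> y \<in> B"
    and "\<And>i j l. i \<le> j \<Longrightarrow> j \<le> l \<Longrightarrow> l < length Bs \<Longrightarrow> Bs ! i \<inter> Bs ! l \<subseteq> Bs ! j"
  shows "pd S k Bs"
  using assms unfolding pd_def by metis

lemma
  assumes "pd S k Bs"
  shows pd_nonempty: "Bs \<noteq> []"
    and pd_Union: "\<Union> (set Bs) = S"
    and pd_card: "B \<in> set Bs \<Longrightarrow> card B \<le> k"
    and pd_edge: "x \<in> S \<Longrightarrow> y \<in> S \<Longrightarrow> (x, y) \<in> E \<Longrightarrow> \<exists>B\<in>set Bs. x \<in> B \<and> y \<in> B"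
    and pd_interval: "i \<le> j \<Longrightarrow> j \<le> l \<Longrightarrow> l < length Bs \<Longrightarrow> x \<in> Bs ! i \<Longrightarrow> x \<in> Bs ! l \<Longrightarrow> x \<in> Bs ! j"
  using assms unfolding pd_def by (metis | blast)+

text \<open>Every bag is intersected with \<open>S'\<close>. Finiteness enters because an infinite
  bag has \<open>card\<close> 0 and would meet any bound.\<close>

lemma has_pd_subset:
  assumes "has_pd S k" "S' \<subseteq> S" "finite S"
  shows "has_pd S' k"
proof -
  obtain Bs where Bs: "pd S k Bs" using assms by (auto simp: has_pd_def)
  let ?Cs = "map (\<lambda>B. B \<inter> S') Bs"
  have "pd S' k ?Cs"
  proof (rule pdI)
    show "?Cs \<noteq> []" using pd_nonempty[OF Bs] by simp
    show "\<Union> (set ?Cs) = S'" using pd_Union[OF Bs] assms(2) by auto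
    fix C assume "C \<in> set ?Cs"
    then obtain B where B: "B \<in> set Bs" "C = B \<inter> S'" by auto
    have "finite B" using B(1) pd_Union[OF Bs] assms(3) by (metis Union_upper finite_subset)
    then have "card C \<le> card B" unfolding B(2) by (intro card_mono) auto
    then show "card C \<le> k" using pd_card[OF Bs B(1)] by simp
  next
    fix x y assume "x \<in> S'" "y \<in> S'" "(x, y) \<in> E"
    then show "\<exists>C\<in>set ?Cs. x \<in> C \<and> y \<in> C" using pd_edge[OF Bs, of x y] assms(2) by auto
  next
    fix i j l assume "i \<le> j" "j \<le> l" "l < length ?Cs"
    then show "?Cs ! i \<inter> ?Cs ! l \<subseteq> ?Cs ! j" using pd_interval[OF Bs, of i j l] by auto
  qed
  then show ?thesis by (auto simp: has_pd_def)
qed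

lemma pd_rev:
  assumes pd: "pd S k Bs"
  shows "pd S k (rev Bs)"
proof (rule pdI)
  fix i j l assume "i \<le> j" "j \<le> l" "l < length (rev Bs)"
  then show "rev Bs ! i \<inter> rev Bs ! l \<subseteq> rev Bs ! j"
    using pd_interval[OF pd, of "length Bs - Suc l" "length Bs - Suc j" "length Bs - Suc i"]
    by (auto simp: rev_nth)
qed (use pd_nonempty[OF pd] pd_Union[OF pd] pd_card[OF pd] pd_edge[OF pd] in auto)

text \<open>A shared vertex lies in both bags at the seam, so its interval in the first sequence
  continues in the second.\<close>

lemma pd_append:
  assumes 1: "pd S k Bs" and 2: "pd S' k Bs'"
    and glue: "S \<inter> S' \<subseteq> last Bs \<inter> hd Bs'"
    and edges: "\<And>x y. x \<in> S - S' \<Longrightarrow> y \<in> S' - S \<Longrightarrow> (x, y) \<notin> E"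
  shows "pd (S \<union> S') k (Bs @ Bs')"
proof (rule pdI)
  fix i j l assume ijl: "i \<le> j" "j \<le> l" "l < length (Bs @ Bs')"
  show "(Bs @ Bs') ! i \<inter> (Bs @ Bs') ! l \<subseteq> (Bs @ Bs') ! j"
  proof
    fix x assume x: "x \<in> (Bs @ Bs') ! i \<inter> (Bs @ Bs') ! l"
    consider "l < length Bs" | "length Bs \<le> i" | "i < length Bs" "length Bs \<le> l" by linarith
    then show "x \<in> (Bs @ Bs') ! j"
    proof cases
      case a: 1
      then show ?thesis using x ijl pd_interval[OF 1, of i j l] by (auto simp: nth_append)
    next
      case a: 2
      have "l - length Bs < length Bs'" using a ijl by auto
      then show ?thesis
        using a x ijl pd_interval[OF 2, of "i - length Bs" "j - length Bs" "l - length Bs"]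
        by (simp add: nth_append)
    next
      case a: 3
      then have xi: "x \<in> Bs ! i" and xl: "x \<in> Bs' ! (l - length Bs)" and l: "l - length Bs < length Bs'"
        using x ijl by (auto simp: nth_append)
      then have "x \<in> S \<inter> S'" using pd_Union[OF 1] pd_Union[OF 2] a by (metis IntI UnionI nth_mem)
      then have "x \<in> last Bs" "x \<in> hd Bs'" using glue by auto
      then have "x \<in> Bs ! (length Bs - 1)" "x \<in> Bs' ! 0"
        using pd_nonempty[OF 1] pd_nonempty[OF 2] by (auto simp: last_conv_nth hd_conv_nth)
      then show ?thesis
        using xi xl l a ijl pd_interval[OF 1, of i j "length Bs - 1" x]
          pd_interval[OF 2, of 0 "j - length Bs" "l - length Bs" x]
        by (cases "j < length Bs") (simp_all add: nth_append)
    qed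
  qed
next
  fix x y assume xy: "x \<in> S \<union> S'" "y \<in> S \<union> S'" "(x, y) \<in> E"
  then have "(x \<in> S \<and> y \<in> S) \<or> (x \<in> S' \<and> y \<in> S')" using edges edge_sym by blast
  then show "\<exists>B\<in>set (Bs @ Bs'). x \<in> B \<and> y \<in> B"
    using pd_edge[OF 1 _ _ xy(3)] pd_edge[OF 2 _ _ xy(3)] by auto
qed (use pd_nonempty[OF 1] pd_Union[OF 1] pd_Union[OF 2] pd_card[OF 1] pd_card[OF 2] in auto)

lemma pd_insert:
  assumes pd: "pd S k Bs"
  shows "pd (insert v S) (Suc k) (map (insert v) Bs)"
proof (rule pdI)
  fix B assume "B \<in> set (map (insert v) Bs)"
  then obtain B' where "B' \<in> set Bs" "B = insert v B'" by auto
  then show "card B \<le> Suc k"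
    using pd_card[OF pd, of B'] card_insert_le_m1[of "Suc k" B' v] by auto
next
  fix x y assume xy: "x \<in> insert v S" "y \<in> insert v S" "(x, y) \<in> E"
  have *: "\<exists>B\<in>set Bs. z \<in> B" if "z \<in> S" for z using pd_Union[OF pd] that by auto
  consider "x = v" "y = v" | "x = v" "y \<in> S" | "x \<in> S" "y = v" | "x \<in> S" "y \<in> S" using xy by auto
  then show "\<exists>B\<in>set (map (insert v) Bs). x \<in> B \<and> y \<in> B"
  proof cases
    case 1
    then show ?thesis using xy edge_irrefl by auto
  qed (use * pd_edge[OF pd _ _ xy(3)] in auto)
next
  fix i j l assume ijl: "i \<le> j" "j \<le> l" "l < length (map (insert v) Bs)"
  then show "map (insert v) Bs ! i \<inter> map (insert v) Bs ! l \<subseteq> map (insert v) Bs ! j"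
    using pd_interval[OF pd, of i j l] by auto
qed (use pd_nonempty[OF pd] pd_Union[OF pd] in auto)

section \<open>Heavy branches, and a vertex with three of them\<close>

text \<open>Since \<open>k\<close> bounds bag sizes, heaviness in a finite \<open>S\<close> means
  that the branch has pathwidth at least \<open>k\<close>.\<close>

definition heavy :: "nat \<Rightarrow> 'a set \<Rightarrow> 'a \<Rightarrow> 'a \<Rightarrow> bool" where
  "heavy k S v w \<longleftrightarrow> w \<in> S \<and> (v, w) \<in> E \<and> \<not> has_pd (branch S v w) k"

text \<open>The light branches are swept one by one while \<open>v\<close> stays in every bag. This
  accounts for the extra place in the bags and makes the pieces fit together at
  \<open>v\<close>.\<close>

lemma pd_star:
  assumes "finite W" "\<And>w. w \<in> W \<Longrightarrow> w \<in> S \<and> (v, w) \<in> E \<and> has_pd (branch S v w) k"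
  shows "\<exists>Bs. pd (insert v (\<Union>w\<in>W. branch S v w)) (Suc k) Bs \<and> (\<forall>B\<in>set Bs. v \<in> B)"
  using assms
proof (induction W)
  case empty
  have "pd {v} (Suc k) [{v}]" using edge_irrefl by (intro pdI) auto
  then show ?case by (intro exI[of _ "[{v}]"]) auto
next
  case (insert w W)
  let ?U = "insert v (\<Union>w\<in>W. branch S v w)"
  obtain Bs where Bs: "pd ?U (Suc k) Bs" "\<forall>B\<in>set Bs. v \<in> B" using insert by auto
  obtain Cs where Cs: "pd (branch S v w) k Cs" using insert.prems by (auto simp: has_pd_def)
  note Cs' = pd_insert[OF Cs, of v]
  have disj: "branch S v w \<inter> branch S v w' = {}" if "w' \<in> W" for w'
    using branch_disjoint insert that by blast
  have sub: "branch S v w' \<subseteq> S - {v}" if "w' \<in> insert w W" for w'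
    using branch_subset insert.prems that by blast
  have "pd (?U \<union> insert v (branch S v w)) (Suc k) (Bs @ map (insert v) Cs)"
  proof (rule pd_append[OF Bs(1) Cs'])
    have "v \<in> last Bs" using Bs pd_nonempty by (metis last_in_set)
    moreover have "v \<in> hd (map (insert v) Cs)" using pd_nonempty[OF Cs] by (simp add: hd_map)
    moreover have "?U \<inter> insert v (branch S v w) \<subseteq> {v}" using disj by blast
    ultimately show "?U \<inter> insert v (branch S v w) \<subseteq> last Bs \<inter> hd (map (insert v) Cs)" by auto
  next
    fix x y assume x: "x \<in> ?U - insert v (branch S v w)" and y: "y \<in> insert v (branch S v w) - ?U"
    obtain w' where w': "w' \<in> W" "x \<in> branch S v w'" using x by auto
    show "(x, y) \<notin> E"
    proof
      assume "(x, y) \<in> E"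
      then have "y \<in> branch S v w'"
        using w' y sub[of w] branch_closed[of v w' S x y] insert.prems by auto
      then show False using w' y by auto
    qed
  qed
  moreover have "?U \<union> insert v (branch S v w) = insert v (\<Union>w\<in>insert w W. branch S v w)" by auto
  ultimately show ?case using Bs(2) by (intro exI[of _ "Bs @ map (insert v) Cs"]) auto
qed

lemma conn_decompose:
  assumes "conn S" "v \<in> S"
  shows "S = insert v (\<Union>w\<in>{w\<in>S. (v, w) \<in> E}. branch S v w)"
proof (intro equalityI subsetI)
  fix x assume "x \<in> S"
  then show "x \<in> insert v (\<Union>w\<in>{w\<in>S. (v, w) \<in> E}. branch S v w)"
    using ex_branch[OF assms, of x] by auto
next
  fix x assume "x \<in> insert v (\<Union>w\<in>{w\<in>S. (v, w) \<in> E}. branch S v w)"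
  then show "x \<in> S" using branch_subset[of v _ S] assms(2) by auto
qed

text \<open>The branch keeps its own bags, without \<open>v\<close>, and starts at its root
  \<open>h\<close>; the separate bag \<open>{v, h}\<close> carries the connecting edge. Its two
  elements fit because \<open>1 \<le> k\<close>.\<close>

lemma pd_attach_branch:
  assumes U: "pd U (Suc k) Bs" "v \<in> last Bs" "U \<subseteq> S" "v \<in> U"
    and h: "(v, h) \<in> E" "h \<in> S" "U \<inter> branch S v h = {}"
    and Cs: "pd (branch S v h) (Suc k) Cs" "h \<in> hd Cs" and "1 \<le> k"
  shows "pd (U \<union> branch S v h) (Suc k) (Bs @ {v, h} # Cs)"
proof -
  have nv: "v \<noteq> h" using h edge_irrefl by auto
  have vB: "v \<notin> branch S v h" using branch_subset[OF h(1,2)] by auto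
  have "pd {v, h} (Suc k) [{v, h}]" using \<open>1 \<le> k\<close> nv by (intro pdI) auto
  then have 1: "pd ({v, h} \<union> branch S v h) (Suc k) ([{v, h}] @ Cs)"
  proof (rule pd_append[OF _ Cs(1)])
    fix x y assume "x \<in> {v, h} - branch S v h" "y \<in> branch S v h - {v, h}"
    then show "(x, y) \<notin> E" using root_in_branch branch_adjacent_root[OF h(1)] by blast
  qed (use vB Cs(2) in auto)
  have "pd (U \<union> ({v, h} \<union> branch S v h)) (Suc k) (Bs @ [{v, h}] @ Cs)"
  proof (rule pd_append[OF U(1) 1])
    show "U \<inter> ({v, h} \<union> branch S v h) \<subseteq> last Bs \<inter> hd ([{v, h}] @ Cs)"
      using h(3) U(2) root_in_branch[of h S v] by auto
    fix x y assume xy: "x \<in> U - ({v, h} \<union> branch S v h)" "y \<in> {v, h} \<union> branch S v h - U"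
    then have "y \<in> branch S v h" using U(4) root_in_branch by auto
    then show "(x, y) \<notin> E" using xy U(3) branch_closed[OF h(1,2), of y x] edge_sym by blast
  qed
  moreover have "U \<union> ({v, h} \<union> branch S v h) = U \<union> branch S v h"
    using U(4) root_in_branch[of h S v] by auto
  ultimately show ?thesis by simp
qed

text \<open>\<open>branch S u w\<close> with \<open>r \<notin> branch S u w\<close> is the subtree below the child \<open>w\<close> of \<open>u\<close> when \<open>S\<close> is
  rooted at \<open>r\<close>.\<close>

lemma pd_rooted:
  assumes "conn S" "finite S" "r \<in> S" "1 \<le> k"
    and "\<And>u w w'. \<lbrakk>u \<in> S; heavy k S u w; heavy k S u w'; r \<notin> branch S u w; r \<notin> branch S u w'\<rbrakk> \<Longrightarrow> w = w'"
  shows "\<exists>Bs. pd S (Suc k) Bs \<and> r \<in> hd Bs"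
  using assms
proof (induction "card S" arbitrary: S r rule: less_induct)
  case less
  let ?N = "{w \<in> S. (r, w) \<in> E}"
  have notin: "r \<notin> branch S r w" if "w \<in> ?N" for w using branch_subset that by blast
  define W where "W = {w \<in> ?N. has_pd (branch S r w) k}"
  have "finite W" using less.prems by (auto simp: W_def)
  moreover have "w \<in> S \<and> (r, w) \<in> E \<and> has_pd (branch S r w) k" if "w \<in> W" for w
    using that by (auto simp: W_def)
  ultimately obtain Bs where Bs: "pd (insert r (\<Union>w\<in>W. branch S r w)) (Suc k) Bs" "\<forall>B\<in>set Bs. r \<in> B"
    using pd_star[of W S r k] by metis
  let ?U = "insert r (\<Union>w\<in>W. branch S r w)"
  have rBs: "r \<in> hd Bs" "r \<in> last Bs" using Bs(2) pd_nonempty[OF Bs(1)] by auto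
  note S = conn_decompose[OF less.prems(1,3)]
  show ?case
  proof (cases "\<exists>h. heavy k S r h")
    case False
    then have "W = ?N" by (auto simp: W_def heavy_def)
    then show ?thesis using S Bs(1) rBs(1) by metis
  next
    case True
    then obtain h where h: "heavy k S r h" by blast
    then have hS: "(r, h) \<in> E" "h \<in> S" by (auto simp: heavy_def)
    let ?B = "branch S r h"
    \<comment> \<open>\<open>h\<close> is the only heavy child of the root, so all other children
      are light.\<close>
    have "w \<in> insert h W" if "w \<in> ?N" for w
      using less.prems(5)[OF less.prems(3) _ h notin[OF that]] notin[of h] that hS
      unfolding W_def heavy_def by blast
    moreover have "W \<subseteq> ?N" "h \<in> ?N" using hS by (auto simp: W_def)
    ultimately have N: "?N = insert h W" by blast
    have sub: "?B \<subseteq> S - {r}" using branch_subset hS by blast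
    then have "card ?B < card S" using less.prems by (intro psubset_card_mono) auto
    moreover have "finite ?B" using sub less.prems by (meson finite_Diff finite_subset)
    \<comment> \<open>The uniqueness hypothesis passes to the branch rooted at \<open>h\<close>,
      because a subtree there that misses \<open>h\<close> is the same set in the branch and in
      \<open>S\<close>, and it misses \<open>r\<close> too.\<close>
    moreover have "w = w'"
      if *: "u \<in> ?B" "heavy k ?B u w" "heavy k ?B u w'" "h \<notin> branch ?B u w" "h \<notin> branch ?B u w'" for u w w'
    proof (rule less.prems(5))
      have eq: "branch S u z = branch ?B u z" if "heavy k ?B u z" "h \<notin> branch ?B u z" for z
        using subbranch_eq[OF hS *(1)] that by (auto simp: heavy_def)
      have lift: "heavy k S u z \<and> r \<notin> branch S u z" if "heavy k ?B u z" "h \<notin> branch ?B u z" for z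
      proof -
        have "branch ?B u z \<subseteq> ?B" using that branch_subset by (auto simp: heavy_def)
        then show ?thesis using eq[OF that] that sub by (auto simp: heavy_def)
      qed
      show "heavy k S u w" "heavy k S u w'" "r \<notin> branch S u w" "r \<notin> branch S u w'"
        using lift * by auto
      show "u \<in> S" using * sub by auto
    qed
    ultimately obtain Cs where Cs: "pd ?B (Suc k) Cs" "h \<in> hd Cs"
      using less.hyps[of ?B h] conn_branch[OF hS] root_in_branch less.prems(4) by metis
    \<comment> \<open>The sequence follows the path of heavy children: the light branches of
      \<open>r\<close>, then \<open>{r, h}\<close>, then the sequence for \<open>h\<close>.\<close>
    have "pd (?U \<union> ?B) (Suc k) (Bs @ {r, h} # Cs)"
    proof (rule pd_attach_branch[OF Bs(1) rBs(2) _ _ hS _ Cs less.prems(4)])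
      show "?U \<subseteq> S" using S[THEN equalityD2] unfolding N by blast
      have "h \<notin> W" using h by (auto simp: W_def heavy_def)
      then have "branch S r w \<inter> ?B = {}" if "w \<in> W" for w
        using branch_disjoint[of r w h] hS that by (auto simp: W_def)
      then show "?U \<inter> ?B = {}" using sub by auto
    qed auto
    moreover have "?U \<union> ?B = S" using S[symmetric] unfolding N by blast
    moreover have "r \<in> hd (Bs @ {r, h} # Cs)" using rBs pd_nonempty[OF Bs(1)] by auto
    ultimately show ?thesis by metis
  qed
qed

text \<open>If \<open>v\<close> has two heavy branches, then from any vertex inside one of them the branch towards \<open>v\<close>
  contains the other one and is heavy too, which leaves at most one heavy subtree pointing away from \<open>v\<close>.\<close>

lemma ex_three_heavy:
  assumes S: "conn S" "finite S" and k: "1 \<le> k" and no: "\<not> has_pd S (Suc k)"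
  shows "\<exists>v\<in>S. \<exists>a b c. heavy k S v a \<and> heavy k S v b \<and> heavy k S v c \<and> a \<noteq> b \<and> a \<noteq> c \<and> b \<noteq> c"
proof (rule ccontr)
  assume "\<not> ?thesis"
  then have le2: "\<And>v a b c. \<lbrakk>v \<in> S; heavy k S v a; heavy k S v b; heavy k S v c; a \<noteq> b; a \<noteq> c\<rbrakk> \<Longrightarrow> b = c"
    by blast
  obtain r where "r \<in> S" using S by (auto simp: conn_def)
  \<comment> \<open>Any root \<open>r\<close> will do: if no vertex had two heavy branches,
    \<open>pd_rooted\<close> would decompose \<open>S\<close>.\<close>
  then obtain v a b where v: "v \<in> S" "heavy k S v a" "heavy k S v b" "a \<noteq> b"
    using pd_rooted[OF S _ k] no unfolding has_pd_def by metis
  have rooted: "\<exists>Cs. pd (branch S v a) (Suc k) Cs \<and> a \<in> hd Cs"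
    if ab: "heavy k S v a" "heavy k S v b" "a \<noteq> b" for a b
  proof (rule pd_rooted[OF _ _ root_in_branch k])
    let ?B = "branch S v a"
    have a: "(v, a) \<in> E" "a \<in> S" and b: "(v, b) \<in> E" "b \<in> S" using ab by (auto simp: heavy_def)
    have sub: "?B \<subseteq> S - {v}" by (rule branch_subset[OF a])
    show "conn ?B" by (rule conn_branch[OF a])
    show "finite ?B" using sub S finite_subset by blast
    fix u w w'
    assume *: "u \<in> ?B" "heavy k ?B u w" "heavy k ?B u w'" "a \<notin> branch ?B u w" "a \<notin> branch ?B u w'"
    have lift: "heavy k S u z \<and> v \<notin> branch S u z" if "heavy k ?B u z" "a \<notin> branch ?B u z" for z
    proof -
      have "branch ?B u z \<subseteq> ?B" using that branch_subset by (auto simp: heavy_def)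
      moreover have "branch S u z = branch ?B u z"
        using subbranch_eq[OF a *(1)] that by (auto simp: heavy_def)
      ultimately show ?thesis using that sub by (auto simp: heavy_def)
    qed
    have u: "u \<in> S" "u \<noteq> v" using * sub by auto
    obtain z where z: "z \<in> S" "(u, z) \<in> E" "v \<in> branch S u z"
      using ex_branch[OF S(1) u(1) v(1)] u(2) by metis
    have ub: "u \<notin> branch S v b" using branch_disjoint[OF a(1) b(1) ab(3)] * by auto
    have "branch S v b \<subseteq> branch S u z \<inter> branch S v b"
    proof (rule branch_least)
      have "b \<noteq> u" using ub root_in_branch[of b S v] by auto
      then have "b \<in> branch S u z"
        using branch_closed[OF z(2,1,3) b(1,2)] by simp
      then show "b \<in> branch S u z \<inter> branch S v b" using root_in_branch by simp
    next
      fix x y assume x: "x \<in> branch S u z \<inter> branch S v b" "x \<in> S - {v}" "y \<in> S - {v}" "(x, y) \<in> E"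
      then have "y \<in> branch S v b" using branch_closed[OF b] by blast
      moreover from this have "y \<noteq> u" using ub by auto
      ultimately show "y \<in> branch S u z \<inter> branch S v b" using x branch_closed[OF z(2,1)] by blast
    qed
    then have "\<not> has_pd (branch S u z) k"
      using has_pd_subset[of "branch S u z" k "branch S v b"] ab(2) branch_subset[OF z(2,1)] S(2)
      by (meson finite_Diff finite_subset heavy_def le_inf_iff)
    then have "heavy k S u z" using z by (simp add: heavy_def)
    moreover have "z \<noteq> w" "z \<noteq> w'" using z(3) lift * by auto
    ultimately show "w = w'" using le2[OF u(1), of z w w'] lift * by blast
  qed
  obtain As where As: "pd (branch S v a) (Suc k) As" "a \<in> hd As" using rooted v by metis
  obtain Cs where Cs: "pd (branch S v b) (Suc k) Cs" "b \<in> hd Cs" using rooted v by metis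
  have ab: "(v, a) \<in> E" "a \<in> S" "(v, b) \<in> E" "b \<in> S" using v by (auto simp: heavy_def)
  define W where "W = {w \<in> S. (v, w) \<in> E \<and> has_pd (branch S v w) k}"
  let ?U = "insert v (\<Union>w\<in>W. branch S v w)"
  have "finite W" using S by (auto simp: W_def)
  moreover have "w \<in> S \<and> (v, w) \<in> E \<and> has_pd (branch S v w) k" if "w \<in> W" for w
    using that by (auto simp: W_def)
  ultimately obtain Bs where Bs: "pd ?U (Suc k) Bs" "\<forall>B\<in>set Bs. v \<in> B"
    using pd_star[of W S v k] by metis
  have vBs: "v \<in> hd Bs" "v \<in> last Bs" using Bs(2) pd_nonempty[OF Bs(1)] by auto
  have N: "{w \<in> S. (v, w) \<in> E} = insert a (insert b W)"
  proof -
    have "w \<in> insert a (insert b W)" if "w \<in> S" "(v, w) \<in> E" for w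
      using le2[OF v(1,2,3), of w] v(4) that unfolding W_def heavy_def by blast
    then show ?thesis using ab unfolding W_def by blast
  qed
  note dec = conn_decompose[OF S(1) v(1), unfolded N, symmetric]
  have US: "?U \<subseteq> S" using dec[THEN equalityD1] by blast
  have nW: "a \<notin> W" "b \<notin> W" using v by (auto simp: W_def heavy_def)
  have disj: "branch S v w \<inter> branch S v a = {}" "branch S v w \<inter> branch S v b = {}" if "w \<in> W" for w
    using branch_disjoint[of v w] ab nW that by (auto simp: W_def)
  have nv: "v \<notin> branch S v a" "v \<notin> branch S v b" using branch_subset ab by blast+
  have 1: "pd (?U \<union> branch S v a) (Suc k) (Bs @ {v, a} # As)"
    using Bs(1) vBs(2) US _ ab(1,2) _ As k
    by (rule pd_attach_branch) (use disj nv in auto)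
  \<comment> \<open>Reversal moves the light part, and with it a bag containing \<open>v\<close>, to
    the end, where the second heavy branch can be attached.\<close>
  have 2: "pd (?U \<union> branch S v a \<union> branch S v b) (Suc k) (rev (Bs @ {v, a} # As) @ {v, b} # Cs)"
    using pd_rev[OF 1] _ _ _ ab(3,4) _ Cs k
  proof (rule pd_attach_branch)
    show "v \<in> last (rev (Bs @ {v, a} # As))"
      using vBs pd_nonempty[OF Bs(1)] by (simp add: last_rev)
    show "?U \<union> branch S v a \<subseteq> S" using dec[THEN equalityD1] by blast
    show "(?U \<union> branch S v a) \<inter> branch S v b = {}"
      using disj nv branch_disjoint[OF ab(1,3) v(4)] by auto
  qed auto
  have "?U \<union> branch S v a \<union> branch S v b = S" using dec by blast
  then show False using 2 no unfolding has_pd_def by metis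
qed

section \<open>Rooting\<close>

text \<open>The neighbour of \<open>x\<close> through which \<open>v\<close> is reached, unique
  because branches at \<open>x\<close> are disjoint. The root is its own parent, so iteration can
  run past it.\<close>

definition par :: "'a set \<Rightarrow> 'a \<Rightarrow> 'a \<Rightarrow> 'a" where
  "par S v x = (if x = v then v else (THE w. w \<in> S \<and> (x, w) \<in> E \<and> v \<in> branch S x w))"

definition dep :: "'a set \<Rightarrow> 'a \<Rightarrow> 'a \<Rightarrow> nat" where
  "dep S v x = (LEAST n. (par S v ^^ n) x = v)"

text \<open>The ancestor of \<open>x\<close> at depth \<open>d\<close>; truncated subtraction leaves
  \<open>x\<close> unchanged when it is not deeper than \<open>d\<close>.\<close>

definition trunc :: "'a set \<Rightarrow> 'a \<Rightarrow> nat \<Rightarrow> 'a \<Rightarrow> 'a" where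
  "trunc S v d x = (par S v ^^ (dep S v x - d)) x"

lemma par_root [simp]: "par S v v = v"
  by (simp add: par_def)

lemma par_eqI:
  assumes "x \<noteq> v" "w \<in> S" "(x, w) \<in> E" "v \<in> branch S x w"
  shows "par S v x = w"
proof -
  have "(THE w. w \<in> S \<and> (x, w) \<in> E \<and> v \<in> branch S x w) = w"
    using assms branch_disjoint by (intro the_equality) blast+
  then show ?thesis using assms(1) by (simp add: par_def)
qed

context
  fixes S v
  assumes conn: "conn S" and v: "v \<in> S"
begin

abbreviation "parent \<equiv> par S v"
abbreviation "depth \<equiv> dep S v"

lemma parent_edge:
  assumes "x \<in> S" "x \<noteq> v"
  shows "parent x \<in> S" "(x, parent x) \<in> E"
  using ex_branch[OF conn assms(1) v] assms(2) par_eqI by metis+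

lemma parent_in: "x \<in> S \<Longrightarrow> parent x \<in> S"
  using parent_edge v by (cases "x = v") auto

lemma edge_parent:
  assumes "x \<in> S" "y \<in> S" "(x, y) \<in> E"
  shows "(y \<noteq> v \<and> parent y = x) \<or> (x \<noteq> v \<and> parent x = y)"
proof (cases "x = v")
  case True
  then have "parent y = x" using assms edge_sym edge_irrefl root_in_branch by (intro par_eqI) auto
  then show ?thesis using True assms edge_irrefl by auto
next
  case False
  obtain w where w: "w \<in> S" "(x, w) \<in> E" "v \<in> branch S x w"
    using ex_branch[OF conn assms(1) v] False by metis
  show ?thesis
  proof (cases "w = y")
    case True
    then show ?thesis using par_eqI[OF False w] False by auto
  next
    case wy: False
    have yw: "y \<notin> branch S x w" using branch_adjacent_root[OF w(2) _ assms(3)] wy by auto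
    then have "y \<noteq> v" using w(3) by auto
    \<comment> \<open>As \<open>y\<close> is not on the way from \<open>x\<close> to the root, the
      whole side of \<open>x\<close> containing \<open>v\<close> is reached from \<open>y\<close>
      through \<open>x\<close>. So \<open>x\<close> is the parent of \<open>y\<close>.\<close>
    have sub: "branch S x w \<subseteq> branch S y x \<inter> branch S x w"
    proof (rule branch_least)
      show "w \<in> branch S y x \<inter> branch S x w"
        using branch_closed[OF edge_sym[OF assms(3)] assms(1) root_in_branch w(2,1)] wy root_in_branch
        by simp
    next
      fix z z' assume z: "z \<in> branch S y x \<inter> branch S x w" "z \<in> S - {x}" "z' \<in> S - {x}" "(z, z') \<in> E"
      then have z': "z' \<in> branch S x w" using branch_closed[OF w(2,1)] by blast
      then have "z' \<noteq> y" using yw by auto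
      then show "z' \<in> branch S y x \<inter> branch S x w"
        using branch_closed[OF edge_sym[OF assms(3)] assms(1)] z z' by blast
    qed
    have "parent y = x"
      using \<open>y \<noteq> v\<close> assms(1) edge_sym[OF assms(3)] sub w(3) by (intro par_eqI) auto
    then show ?thesis using \<open>y \<noteq> v\<close> by simp
  qed
qed

text \<open>Along a walk from \<open>v\<close>, each edge adds one parent step or removes
  one.\<close>

lemma ex_funpow_parent:
  assumes "x \<in> S"
  shows "\<exists>n. (parent ^^ n) x = v"
proof -
  have "(v, x) \<in> (E \<inter> S \<times> S)\<^sup>*" using conn v assms by (auto simp: conn_def)
  then show ?thesis
  proof induction
    case base
    show ?case by (rule exI[of _ 0]) simp
  next
    case (step y z)
    then obtain n where n: "(parent ^^ n) y = v" by blast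
    consider "parent z = y" | "y \<noteq> v" "parent y = z" using edge_parent[of y z] step by auto
    then show ?case
    proof cases
      case 1
      then have "(parent ^^ Suc n) z = v" using n by (simp add: funpow_swap1)
      then show ?thesis by blast
    next
      case 2
      then obtain m where "n = Suc m" using n by (cases n) auto
      then have "(parent ^^ m) z = v" using n 2 by (simp add: funpow_swap1)
      then show ?thesis by blast
    qed
  qed
qed

lemma depth_root [simp]: "depth v = 0"
  by (simp add: dep_def)

lemma depth_parent:
  assumes "x \<in> S" "x \<noteq> v"
  shows "depth x = Suc (depth (parent x))"
proof -
  obtain n where "(parent ^^ n) x = v" using ex_funpow_parent assms by blast
  then have "(LEAST n. (parent ^^ n) x = v) = Suc (LEAST n. (parent ^^ Suc n) x = v)"
    using assms(2) by (intro Least_Suc) auto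
  then show ?thesis by (simp add: dep_def funpow_swap1)
qed

lemma depth_edge:
  "x \<in> S \<Longrightarrow> y \<in> S \<Longrightarrow> (x, y) \<in> E \<Longrightarrow> depth y = Suc (depth x) \<or> depth x = Suc (depth y)"
  using edge_parent depth_parent by metis

lemma funpow_parent_in: "x \<in> S \<Longrightarrow> (parent ^^ n) x \<in> S"
  by (induction n) (auto intro: parent_in)

lemma depth_funpow_parent:
  assumes "x \<in> S"
  shows "depth ((parent ^^ n) x) = depth x - n"
proof (induction n)
  case (Suc n)
  then show ?case
    using depth_parent[OF funpow_parent_in[OF assms], of n] by (cases "(parent ^^ n) x = v") auto
qed simp

lemma depth_trunc: "x \<in> S \<Longrightarrow> depth (trunc S v d x) = min d (depth x)"
  by (simp add: trunc_def depth_funpow_parent)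

lemma trunc_self: "depth x \<le> d \<Longrightarrow> trunc S v d x = x"
  by (simp add: trunc_def)

lemma depth_0: "x \<in> S \<Longrightarrow> depth x = 0 \<Longrightarrow> x = v"
  using depth_parent by force

lemma funpow_parent_adjacent:
  assumes "x \<in> S" "m \<le> Suc n" "n \<le> Suc m"
  shows "(parent ^^ m) x = (parent ^^ n) x \<or> ((parent ^^ m) x, (parent ^^ n) x) \<in> E"
proof -
  have *: "(parent ^^ n) x = (parent ^^ Suc n) x \<or> ((parent ^^ n) x, (parent ^^ Suc n) x) \<in> E" for n
    using parent_edge(2)[OF funpow_parent_in[OF assms(1)], of n] by (cases "(parent ^^ n) x = v") auto
  consider "m = n" | "m = Suc n" | "n = Suc m" using assms by linarith
  then show ?thesis
  proof cases
    case 2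
    then show ?thesis using *[of n] edge_sym by metis
  next
    case 3
    then show ?thesis using *[of m] by metis
  qed simp
qed

text \<open>Both truncations are iterated parents of one vertex, the deeper of \<open>x\<close> and
  \<open>y\<close>, and the numbers of iterations differ by at most one.\<close>

lemma trunc_adjacent:
  assumes "x \<in> S" "y \<in> S" "x = y \<or> (x, y) \<in> E" and d: "d \<le> Suc d'" "d' \<le> Suc d"
  shows "trunc S v d x = trunc S v d' y \<or> (trunc S v d x, trunc S v d' y) \<in> E"
proof -
  have up: "trunc S v e z = trunc S v e' u \<or> (trunc S v e z, trunc S v e' u) \<in> E"
    if "u \<in> S" "u \<noteq> v" "parent u = z" "e \<le> Suc e'" "e' \<le> Suc e" for u z e e'
  proof -
    have "trunc S v e z = (parent ^^ Suc (depth z - e)) u"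
      using that by (simp add: trunc_def funpow_swap1)
    moreover have "trunc S v e' u = (parent ^^ (Suc (depth z) - e')) u"
      using depth_parent[OF that(1,2)] that(3) by (simp add: trunc_def)
    ultimately show ?thesis
      using funpow_parent_adjacent[OF that(1), of "Suc (depth z - e)" "Suc (depth z) - e'"] that(4,5)
      by auto
  qed
  consider "x = y" | "y \<noteq> v" "parent y = x" | "x \<noteq> v" "parent x = y"
    using assms edge_parent by blast
  then show ?thesis
  proof cases
    case 1
    then show ?thesis
      using funpow_parent_adjacent[OF assms(1), of "depth x - d" "depth x - d'"] d
      by (simp add: trunc_def)
  next
    case 2
    then show ?thesis using up assms d by blast
  next
    case 3
    then show ?thesis using up[of x y d' d] assms d edge_sym by metis
  qed
qed

end

section \<open>The evader\<close>

text \<open>Time is restricted to a window so that walks can be built between marks and joined. The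
  case \<open>k = 0\<close> is allowed and starts the induction on the number of lions.\<close>

definition lions :: "'a set \<Rightarrow> nat \<Rightarrow> (nat \<Rightarrow> nat \<Rightarrow> 'a) \<Rightarrow> nat \<Rightarrow> nat \<Rightarrow> bool" where
  "lions S k p a b \<longleftrightarrow> (\<forall>i<k. (\<forall>t\<in>{a..b}. p i t \<in> S) \<and>
     (\<forall>t\<in>{a..<b}. p i (Suc t) = p i t \<or> (p i t, p i (Suc t)) \<in> E))"

definition evader :: "'a set \<Rightarrow> nat \<Rightarrow> (nat \<Rightarrow> nat \<Rightarrow> 'a) \<Rightarrow> nat \<Rightarrow> nat \<Rightarrow> (nat \<Rightarrow> 'a) \<Rightarrow> bool" where
  "evader S k p a b x \<longleftrightarrow>
     (\<forall>t\<in>{a..b}. x t \<in> S \<and> (\<forall>i<k. p i t \<noteq> x t)) \<and>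
     (\<forall>t\<in>{a..<b}. (x (Suc t) = x t \<or> (x t, x (Suc t)) \<in> E) \<and>
        (\<forall>i<k. \<not> (p i t = x (Suc t) \<and> p i (Suc t) = x t)))"

definition evade :: "'a set \<Rightarrow> nat \<Rightarrow> bool" where
  "evade S k \<longleftrightarrow> (\<forall>p a b. a \<le> b \<longrightarrow> lions S k p a b \<longrightarrow> (\<exists>x. evader S k p a b x))"

lemma lions_subinterval:
  "lions S k p a b \<Longrightarrow> a \<le> s \<Longrightarrow> t \<le> b \<Longrightarrow> lions S k p s t"
  unfolding lions_def by auto

lemma evader_concat:
  assumes x: "evader S k p a s x" and y: "evader S k p s t y" and "x s = y s" "a \<le> s" "s \<le> t"
  shows "evader S k p a t (\<lambda>u. if u \<le> s then x u else y u)"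
proof -
  let ?z = "\<lambda>u. if u \<le> s then x u else y u"
  have 1: "?z u = x u" if "u \<in> {a..s}" for u using that by auto
  have 2: "?z u = y u" if "u \<in> {s..t}" for u using that assms(3) by auto
  show ?thesis unfolding evader_def
  proof (intro conjI ballI)
    fix u assume "u \<in> {a..t}"
    then consider "u \<in> {a..s}" | "u \<in> {s..t}" by fastforce
    then have "?z u \<in> S \<and> (\<forall>i<k. p i u \<noteq> ?z u)"
      by cases (use 1 2 x y in \<open>auto simp: evader_def\<close>)
    then show "?z u \<in> S" "\<forall>i<k. p i u \<noteq> ?z u" by auto
  next
    fix u assume "u \<in> {a..<t}"
    then consider "u \<in> {a..<s}" | "u \<in> {s..<t}" by fastforce
    then have "(?z (Suc u) = ?z u \<or> (?z u, ?z (Suc u)) \<in> E) \<and>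
        (\<forall>i<k. \<not> (p i u = ?z (Suc u) \<and> p i (Suc u) = ?z u))"
    proof cases
      case a: 1
      then have "?z u = x u" "?z (Suc u) = x (Suc u)" by auto
      then show ?thesis using a x by (simp only:) (auto simp: evader_def)
    next
      case a: 2
      then have "?z u = y u" "?z (Suc u) = y (Suc u)" using 2[of u] by auto
      then show ?thesis using a y by (simp only:) (auto simp: evader_def)
    qed
    then show "?z (Suc u) = ?z u \<or> (?z u, ?z (Suc u)) \<in> E"
      "\<forall>i<k. \<not> (p i u = ?z (Suc u) \<and> p i (Suc u) = ?z u)" by blast+
  qed
qed

text \<open>At each time some lion \<open>e t\<close> is outside \<open>B\<close>. Lions outside are projected to \<open>r\<close>, and whenever \<open>e\<close>
  changes, the new and the old exempt lion project to \<open>r\<close> in both steps, so that one of the other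
  lions can silently swap its identity.\<close>

lemma evade_one_outside:
  assumes ev: "evade B m" and ab: "a \<le> b" and li: "lions S (Suc m) p a b"
    and out: "\<And>t. t \<in> {a..b} \<Longrightarrow> \<exists>i<Suc m. p i t \<notin> B"
    and r: "r \<in> B" "\<And>x y. x \<in> B \<Longrightarrow> y \<in> S - B \<Longrightarrow> (x, y) \<in> E \<Longrightarrow> x = r"
  shows "\<exists>x. evader B (Suc m) p a b x"
proof -
  obtain e where e: "\<And>t. t \<in> {a..b} \<Longrightarrow> e t < Suc m \<and> p (e t) t \<notin> B" using out by metis
  \<comment> \<open>\<open>\<sigma> n\<close> tells which lion each of the \<open>m\<close>
    simulated lions plays at time \<open>a + n\<close>. At first, index \<open>m\<close> replaces
    \<open>e a\<close>; later, whoever plays the next exempt lion takes over the previous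
    one.\<close>
  define \<sigma> where "\<sigma> = rec_nat (\<lambda>j. if j = e a then m else j)
    (\<lambda>n f j. if f j = e (a + Suc n) then e (a + n) else f j)"
  have \<sigma>0: "\<sigma> 0 = (\<lambda>j. if j = e a then m else j)"
    and \<sigma>Suc: "\<sigma> (Suc n) = (\<lambda>j. if \<sigma> n j = e (a + Suc n) then e (a + n) else \<sigma> n j)" for n
    by (auto simp: \<sigma>_def)
  have cover: "a + n \<le> b \<Longrightarrow> i < Suc m \<Longrightarrow> i \<noteq> e (a + n) \<Longrightarrow> \<exists>j<m. \<sigma> n j = i" for n i
  proof (induction n arbitrary: i)
    case 0
    then have "e a < Suc m" using e[of a] ab by auto
    show ?case
    proof (cases "i = m")
      case True
      then show ?thesis using 0 \<open>e a < Suc m\<close> by (intro exI[of _ "e a"]) (auto simp: \<sigma>0)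
    next
      case False
      then show ?thesis using 0 by (intro exI[of _ i]) (auto simp: \<sigma>0)
    qed
  next
    case (Suc n)
    have es: "e (a + Suc n) < Suc m" using e[of "a + Suc n"] Suc.prems by auto
    show ?case
    proof (cases "i = e (a + n)")
      case True
      then obtain j where "j < m" "\<sigma> n j = e (a + Suc n)"
        using Suc.IH[of "e (a + Suc n)"] Suc.prems es by auto
      then show ?thesis using True by (auto simp: \<sigma>Suc)
    next
      case False
      then obtain j where "j < m" "\<sigma> n j = i" using Suc.IH[of i] Suc.prems by auto
      then show ?thesis using Suc.prems by (auto simp: \<sigma>Suc)
    qed
  qed
  have bound: "a + n \<le> b \<Longrightarrow> j < m \<Longrightarrow> \<sigma> n j < Suc m" for n j
  proof (induction n)
    case 0
    then show ?case by (auto simp: \<sigma>0)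
  next
    case (Suc n)
    then show ?case using e[of "a + n"] by (auto simp: \<sigma>Suc)
  qed
  define \<pi> where "\<pi> z = (if z \<in> B then z else r)" for z
  define q where "q j t = \<pi> (p (\<sigma> (t - a) j) t)" for j t
  have step: "p i (Suc t) = p i t \<or> (p i t, p i (Suc t)) \<in> E" and inS: "p i t \<in> S" "p i (Suc t) \<in> S"
    if "i < Suc m" "t \<in> {a..<b}" for i t
    using li that unfolding lions_def by auto
  \<comment> \<open>Within \<open>B\<close> only \<open>r\<close> has edges to the outside, so a
    lion outside \<open>B\<close> at one end of a step projects to \<open>r\<close> at the other end
    too.\<close>
  have leave: "\<pi> (p i t) = r" if "i < Suc m" "t \<in> {a..<b}" "p i (Suc t) \<notin> B" for i t
    using step[OF that(1,2)] inS[OF that(1,2)] that(3) r(2)[of "p i t" "p i (Suc t)"]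
    by (auto simp: \<pi>_def)
  have enter: "\<pi> (p i (Suc t)) = r" if "i < Suc m" "t \<in> {a..<b}" "p i t \<notin> B" for i t
    using step[OF that(1,2)] inS[OF that(1,2)] that(3) r(2)[of "p i (Suc t)" "p i t"] edge_sym
    by (auto simp: \<pi>_def)
  have proj: "\<pi> (p i (Suc t)) = \<pi> (p i t) \<or> (\<pi> (p i t), \<pi> (p i (Suc t))) \<in> E"
    if "i < Suc m" "t \<in> {a..<b}" for i t
    using step[OF that] leave[OF that] enter[OF that] by (auto simp: \<pi>_def)
  have "lions B m q a b"
    unfolding lions_def
  proof (intro allI impI conjI ballI)
    fix j t
    show "q j t \<in> B" using r(1) by (auto simp: q_def \<pi>_def)
  next
    fix j t assume j: "j < m" and t: "t \<in> {a..<b}"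
    define n where "n = t - a"
    have n: "t = a + n" "Suc t - a = Suc n" using t by (auto simp: n_def)
    have bd: "\<sigma> n j < Suc m" using bound[of n j] j t n by auto
    show "q j (Suc t) = q j t \<or> (q j t, q j (Suc t)) \<in> E"
    proof (cases "\<sigma> n j = e (Suc t)")
      case True
      have "q j t = r" using True leave[OF bd t] e[of "Suc t"] t by (auto simp: q_def n_def)
      moreover have "q j (Suc t) = \<pi> (p (e t) (Suc t))" using True n by (simp add: q_def \<sigma>Suc)
      moreover have "\<dots> = r" using enter[of "e t" t] e[of t] t by auto
      ultimately show ?thesis by simp
    next
      case False
      then have "q j (Suc t) = \<pi> (p (\<sigma> n j) (Suc t))" using n by (simp add: q_def \<sigma>Suc)
      then show ?thesis using proj[OF bd t] by (simp add: q_def n_def)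
    qed
  qed
  then obtain x where x: "evader B m q a b x" using ev ab unfolding evade_def by blast
  have repr: "\<exists>j<m. \<sigma> (t - a) j = i" if "i < Suc m" "t \<in> {a..b}" "p i t \<in> B" for i t
  proof (rule cover)
    show "i \<noteq> e (a + (t - a))" using that e[of t] by auto
  qed (use that in auto)
  have "evader B (Suc m) p a b x"
    unfolding evader_def
  proof (intro conjI ballI allI impI)
    fix t assume t: "t \<in> {a..b}"
    show xB: "x t \<in> B" using x t by (auto simp: evader_def)
    fix i assume i: "i < Suc m"
    show "p i t \<noteq> x t"
    proof
      assume eq: "p i t = x t"
      then obtain j where "j < m" "\<sigma> (t - a) j = i" using repr[OF i t] xB by auto
      then have "q j t = x t" using eq xB by (simp add: q_def \<pi>_def)
      then show False using x t \<open>j < m\<close> by (auto simp: evader_def)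
    qed
  next
    fix t assume t: "t \<in> {a..<b}"
    show "x (Suc t) = x t \<or> (x t, x (Suc t)) \<in> E" using x t by (auto simp: evader_def)
    fix i assume i: "i < Suc m"
    show "\<not> (p i t = x (Suc t) \<and> p i (Suc t) = x t)"
    proof
      assume eq: "p i t = x (Suc t) \<and> p i (Suc t) = x t"
      have xB: "x t \<in> B" "x (Suc t) \<in> B" using x t by (auto simp: evader_def)
      then obtain j where j: "j < m" "\<sigma> (t - a) j = i" using repr[OF i, of t] eq t by auto
      \<comment> \<open>Being inside \<open>B\<close> at time \<open>Suc t\<close>, lion
        \<open>i\<close> is not exempt then, so its simulated lion does not swap and makes the same
        move.\<close>
      have "i \<noteq> e (Suc t)" using e[of "Suc t"] eq xB t by auto
      then have "\<sigma> (Suc t - a) j = i" using j t by (simp add: \<sigma>Suc Suc_diff_le)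
      then have "q j t = x (Suc t)" "q j (Suc t) = x t" using eq xB j by (simp_all add: q_def \<pi>_def)
      then show False using x t j(1) by (auto simp: evader_def)
    qed
  qed
  then show ?thesis by blast
qed

text \<open>The evader's walk inside the branch is cut off at depth \<open>D t\<close>, the time distance to the ends of the
  interval at which all lions are in other branches: the lions cannot get that deep yet.\<close>

lemma evade_via_branch:
  assumes S: "conn S" "finite S" "v \<in> S" and c: "(v, c) \<in> E" "c \<in> S"
    and ev: "evade (branch S v c) m" and ab: "a \<le> b" and li: "lions S (Suc m) p a b"
    and out: "\<And>t. t \<in> {a..b} \<Longrightarrow> \<exists>i<Suc m. p i t \<notin> branch S v c"
    and ma: "ma \<Longrightarrow> \<forall>i<Suc m. p i a \<notin> insert v (branch S v c)"
    and mb: "mb \<Longrightarrow> \<forall>i<Suc m. p i b \<notin> insert v (branch S v c)"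
  shows "\<exists>x. evader S (Suc m) p a b x \<and> (ma \<longrightarrow> x a = v) \<and> (mb \<longrightarrow> x b = v)"
proof -
  let ?B = "branch S v c" and ?d = "dep S v"
  note B = branch_subset[OF c] and closed = branch_closed[OF c]
  obtain x where x: "evader ?B (Suc m) p a b x"
  proof -
    have "\<exists>x. evader ?B (Suc m) p a b x"
    proof (rule evade_one_outside[OF ev ab li out root_in_branch])
      fix y z assume yz: "y \<in> ?B" "z \<in> S - ?B" "(y, z) \<in> E"
      then have "z = v" using closed by blast
      then show "y = c" using branch_adjacent_root[OF c(1) yz(1)] yz(3) edge_sym by blast
    qed
    then show ?thesis using that by blast
  qed
  then have xB: "x t \<in> ?B" if "t \<in> {a..b}" for t using that by (auto simp: evader_def)
  have xS: "x t \<in> S" if "t \<in> {a..b}" for t using xB[OF that] B by auto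
  \<comment> \<open>\<open>N\<close> bounds every depth and every value of \<open>h\<close> below,
    so in \<open>D\<close> it means "no restriction" at an end that is not a mark.\<close>
  define N where "N = Suc (Max (?d ` S))"
  define D where "D t = min (if ma then t - a else N) (if mb then b - t else N)" for t
  \<comment> \<open>\<open>h\<close> measures how far a lion has got into the branch: 0 elsewhere, 1
    at \<open>v\<close>, then the depth plus one. The branch can only be entered through
    \<open>v\<close>, so \<open>h\<close> grows by at most one per step.\<close>
  define h where "h z = (if z \<in> ?B then Suc (?d z) else if z = v then 1 else 0)" for z
  have hstep: "h z \<le> Suc (h y)" if "y \<in> S" "z \<in> S" "y = z \<or> (y, z) \<in> E" for y z
  proof (cases "y = z")
    case False
    then have yz: "(y, z) \<in> E" using that by auto
    have "y = v" if "z \<in> ?B" "y \<notin> ?B" using closed[OF that(1) edge_sym[OF yz] \<open>y \<in> S\<close>] that(2) by auto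
    then show ?thesis using depth_edge[OF S(1,3) that(1,2) yz] S by (auto simp: h_def depth_root)
  qed simp
  have pS: "p i t \<in> S" if "i < Suc m" "t \<in> {a..b}" for i t using li that by (auto simp: lions_def)
  have pstep: "p i (Suc t) = p i t \<or> (p i t, p i (Suc t)) \<in> E" if "i < Suc m" "t \<in> {a..<b}" for i t
    using li that by (auto simp: lions_def)
  have ha: "h (p i t) \<le> t - a" if "ma" "i < Suc m" "a \<le> t" "t \<le> b" for i t
    using that(3,4)
  proof (induction t rule: dec_induct)
    case base
    then show ?case using ma that by (auto simp: h_def)
  next
    case (step t)
    then have "h (p i (Suc t)) \<le> Suc (h (p i t))"
      using pS[OF that(2)] pstep[OF that(2), of t] by (intro hstep) auto
    then show ?case using step by auto
  qed
  have hb: "h (p i t) \<le> b - t" if "mb" "i < Suc m" "a \<le> t" "t \<le> b" for i t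
    using that(4,3)
  proof (induction t rule: inc_induct)
    case base
    then show ?case using mb that by (auto simp: h_def)
  next
    case (step t)
    then have "h (p i t) \<le> Suc (h (p i (Suc t)))"
      using pS[OF that(2)] pstep[OF that(2), of t] edge_sym by (intro hstep) auto
    then show ?case using step by auto
  qed
  have hN: "h z \<le> N" if "z \<in> S" for z
    using that S(2) by (auto simp: h_def N_def)
  have hD: "h (p i t) \<le> D t" if "i < Suc m" "t \<in> {a..b}" for i t
    using ha[of i t] hb[of i t] hN[OF pS[OF that]] that by (auto simp: D_def)
  have Dstep: "D (Suc t) \<le> Suc (D t)" "D t \<le> Suc (D (Suc t))" if "t \<in> {a..<b}" for t
    using that by (auto simp: D_def)
  define y where "y t = trunc S v (D t) (x t)" for t
  have yB: "y t \<in> insert v ?B" if "t \<in> {a..b}" for t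
  proof -
    have "(par S v ^^ n) z \<in> insert v ?B" if "z \<in> ?B" for n z
    proof (induction n)
      case (Suc n)
      let ?u = "(par S v ^^ n) z"
      show ?case
      proof (cases "?u = v")
        case False
        then have u: "?u \<in> ?B" "?u \<in> S" using Suc B by auto
        then show ?thesis using parent_edge[OF S(1,3) u(2) False] closed[OF u(1)] by auto
      qed simp
    qed (use that in auto)
    then show ?thesis using xB[OF that] by (simp add: y_def trunc_def)
  qed
  have yS: "y t \<in> S" if "t \<in> {a..b}" for t using yB[OF that] B S by auto
  have dy: "?d (y t) = min (D t) (?d (x t))" if "t \<in> {a..b}" for t
    using depth_trunc[OF S(1,3) xS[OF that]] by (simp add: y_def)
  \<comment> \<open>On the evader's range \<open>h\<close> is the depth plus one, which makes the
    inequality strict. For \<open>s = t\<close> the cut was therefore inactive, and the meeting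
    would already be one with \<open>x\<close>.\<close>
  have caught: "?d (y s) < D t" if "i < Suc m" "t \<in> {a..b}" "s \<in> {a..b}" "p i t = y s" for i s t
  proof -
    have "h (y s) = Suc (?d (y s))"
      using yB[OF that(3)] B S depth_root by (auto simp: h_def)
    then show ?thesis using hD[OF that(1,2)] that(4) by auto
  qed
  have yx: "y t = x t" if "t \<in> {a..b}" "?d (x t) \<le> D t" for t
    using trunc_self that(2) S by (simp add: y_def)
  have "evader S (Suc m) p a b y"
    unfolding evader_def
  proof (intro conjI ballI allI impI)
    fix t assume t: "t \<in> {a..b}"
    show "y t \<in> S" by (rule yS[OF t])
    fix i assume i: "i < Suc m"
    show "p i t \<noteq> y t"
    proof
      assume eq: "p i t = y t"
      then have "?d (x t) \<le> D t" using caught[OF i t t] dy[OF t] by auto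
      then have "p i t = x t" using yx[OF t] eq by simp
      then show False using x i t by (auto simp: evader_def)
    qed
  next
    fix t assume t: "t \<in> {a..<b}"
    then have t': "t \<in> {a..b}" "Suc t \<in> {a..b}" by auto
    have xst: "x (Suc t) = x t \<or> (x t, x (Suc t)) \<in> E" using x t by (auto simp: evader_def)
    then show "y (Suc t) = y t \<or> (y t, y (Suc t)) \<in> E"
      using trunc_adjacent[OF S(1,3) xS[OF t'(1)] xS[OF t'(2)], of "D t" "D (Suc t)"] Dstep[OF t]
      unfolding y_def by metis
    fix i assume i: "i < Suc m"
    show "\<not> (p i t = y (Suc t) \<and> p i (Suc t) = y t)"
    proof
      assume eq: "p i t = y (Suc t) \<and> p i (Suc t) = y t"
      have dx: "?d (x (Suc t)) \<le> Suc (?d (x t)) \<and> ?d (x t) \<le> Suc (?d (x (Suc t)))"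
        using xst depth_edge[OF S(1,3) xS[OF t'(1)] xS[OF t'(2)]] by auto
      \<comment> \<open>If \<open>x t\<close> were deeper than \<open>D t\<close>, then
        \<open>y t\<close> would have depth \<open>D t < D (Suc t)\<close> and
        \<open>x (Suc t)\<close> depth below \<open>D t\<close>, a jump of at least two. The other
        end is symmetric.\<close>
      have "?d (y (Suc t)) < D t" "?d (y t) < D (Suc t)" using caught i t' eq by auto
      then have "?d (x t) \<le> D t" "?d (x (Suc t)) \<le> D (Suc t)"
        using dx Dstep[OF t] dy[OF t'(1)] dy[OF t'(2)] by linarith+
      then have "p i t = x (Suc t) \<and> p i (Suc t) = x t" using eq yx t' by auto
      then show False using x t i by (auto simp: evader_def)
    qed
  qed
  moreover have "y a = v" if ma
    using depth_0[OF S(1,3) yS] dy[of a] that ab by (auto simp: D_def)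
  moreover have "y b = v" if mb
    using depth_0[OF S(1,3) yS] dy[of b] that ab by (auto simp: D_def)
  ultimately show ?thesis by blast
qed

text \<open>Safe walks between consecutive marks are joined at \<open>v\<close>, which carries no
  lion at a mark because all lions are then inside one branch.\<close>

lemma evade_three_branches:
  assumes S: "conn S" "finite S" "v \<in> S"
    and C: "card C = 3" "\<And>c. c \<in> C \<Longrightarrow> c \<in> S \<and> (v, c) \<in> E \<and> evade (branch S v c) m"
  shows "evade S (Suc m)"
  unfolding evade_def
proof (intro allI impI)
  fix p a b assume ab: "a \<le> (b::nat)" and li: "lions S (Suc m) p a b"
  define full where "full c t \<longleftrightarrow> (\<forall>i<Suc m. p i t \<in> branch S v c)" for c t
  define mark where "mark t \<longleftrightarrow> (\<exists>c\<in>C. full c t)" for t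
  have uniq: "c = c'" if "c \<in> C" "c' \<in> C" "full c t" "full c' t" for c c' t
    using branch_disjoint[of v c c' S] C(2) that by (auto simp: full_def)
  \<comment> \<open>At any time at most one branch is full, so two times exclude at most two of the
    three.\<close>
  have pick: "\<exists>c\<in>C. \<not> full c s \<and> \<not> full c t" for s t
  proof (rule ccontr)
    assume "\<not> ?thesis"
    then have "C = {c \<in> C. full c s} \<union> {c \<in> C. full c t}" by blast
    moreover have "card {c \<in> C. full c u} \<le> 1" for u
      using uniq by (auto simp: card_le_Suc0_iff_eq C(1) card_ge_0_finite)
    ultimately have "card C \<le> 1 + 1"
      using card_Un_le[of "{c \<in> C. full c s}" "{c \<in> C. full c t}"] by (metis add_mono order_trans)
    then show False using C(1) by simp
  qed
  have gap: "\<exists>x. evader S (Suc m) p s t x \<and> (mark s \<longrightarrow> x s = v) \<and> (mark t \<longrightarrow> x t = v)"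
    if st: "a \<le> s" "s \<le> t" "t \<le> b" and no: "\<And>u. s < u \<Longrightarrow> u < t \<Longrightarrow> \<not> mark u" for s t
  proof -
    obtain c where c: "c \<in> C" "\<not> full c s" "\<not> full c t" using pick by blast
    then have c': "(v, c) \<in> E" "c \<in> S" "evade (branch S v c) m" using C by auto
    \<comment> \<open>At a mark where \<open>c\<close> is not full, all lions are in another branch,
      hence also not at \<open>v\<close>.\<close>
    have away: "\<forall>i<Suc m. p i u \<notin> insert v (branch S v c)" if u: "mark u" "\<not> full c u" for u
    proof -
      obtain c'' where c'': "c'' \<in> C" "full c'' u" using u by (auto simp: mark_def)
      then have "branch S v c'' \<inter> insert v (branch S v c) = {}"
        using branch_disjoint[of v c'' c S] branch_subset[of v c'' S] C(2)[OF c''(1)] c' u by blast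
      then show ?thesis using c'' unfolding full_def by blast
    qed
    show ?thesis
    proof (rule evade_via_branch[OF S c' st(2) lions_subinterval[OF li st(1,3)]])
      fix u assume "u \<in> {s..t}"
      then have "\<not> full c u" using no[of u] c by (cases "u = s \<or> u = t") (auto simp: mark_def)
      then show "\<exists>i<Suc m. p i u \<notin> branch S v c" by (auto simp: full_def)
    qed (use away c in auto)
  qed
  have "\<exists>x. evader S (Suc m) p a t x \<and> (mark t \<longrightarrow> x t = v)" if "a \<le> t" "t \<le> b" for t
    using that
  proof (induction t rule: less_induct)
    case (less t)
    let ?M = "{u. a \<le> u \<and> u < t \<and> mark u}"
    show ?case
    proof (cases "?M = {}")
      case True
      then show ?thesis using gap[of a t] less.prems by auto
    next
      case False
      \<comment> \<open>The latest mark before \<open>t\<close>, so that no mark lies strictly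
        between \<open>s\<close> and \<open>t\<close>.\<close>
      define s where "s = Max ?M"
      have "s \<in> ?M" unfolding s_def using False by (intro Max_in) auto
      then have s: "a \<le> s" "s < t" "mark s" by auto
      have no: "\<not> mark u" if "s < u" "u < t" for u
      proof
        assume "mark u"
        then have "u \<le> s" unfolding s_def using that s by (intro Max_ge) auto
        then show False using that by simp
      qed
      obtain x where x: "evader S (Suc m) p a s x" "x s = v" using less.IH[of s] s less.prems by auto
      obtain y where y: "evader S (Suc m) p s t y" "y s = v" "mark t \<longrightarrow> y t = v"
        using gap[of s t] no s less.prems by (metis less_imp_le)
      have "evader S (Suc m) p a t (\<lambda>u. if u \<le> s then x u else y u)"
        using evader_concat[OF x(1) y(1)] x y s by auto
      then show ?thesis using y(3) s by (intro exI[of _ "\<lambda>u. if u \<le> s then x u else y u"]) auto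
    qed
  qed
  then show "\<exists>x. evader S (Suc m) p a b x" using ab by blast
qed

text \<open>Going down to a heavy branch lowers both the bag size and the number of lions by one.
  With no lions left, the evader stands still.\<close>

lemma evade_if_no_pd:
  assumes "conn S" "finite S" "\<not> has_pd S (Suc k)"
  shows "evade S k"
  using assms
proof (induction k arbitrary: S)
  case 0
  then obtain s where "s \<in> S" by (auto simp: conn_def)
  then show ?case by (auto simp: evade_def evader_def intro!: exI[of _ "\<lambda>_. s"])
next
  case (Suc k)
  then obtain v a b c where v: "v \<in> S" "heavy (Suc k) S v a" "heavy (Suc k) S v b" "heavy (Suc k) S v c"
    "a \<noteq> b" "a \<noteq> c" "b \<noteq> c"
    using ex_three_heavy[of S "Suc k"] by auto
  have "evade (branch S v w) k" if "heavy (Suc k) S v w" for w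
  proof (rule Suc.IH)
    show "conn (branch S v w)" using conn_branch that by (auto simp: heavy_def)
    show "finite (branch S v w)"
      using branch_subset[of v w S] that Suc.prems(2) finite_subset[of "branch S v w" S] by (auto simp: heavy_def)
    show "\<not> has_pd (branch S v w) (Suc k)" using that by (auto simp: heavy_def)
  qed
  then show ?case
    using evade_three_branches[OF Suc.prems(1,2) v(1), of "{a, b, c}" k] v by (auto simp: heavy_def)
qed

end

section \<open>Sweeping along a path decomposition\<close>

text \<open>The time is existentially quantified, so lion walks of unspecified length can be
  appended.\<close>

definition can_clear :: "'a pair_pre_digraph \<Rightarrow> nat \<Rightarrow> (nat \<Rightarrow> 'a) \<Rightarrow> 'a set \<Rightarrow> bool" where
  "can_clear G k q X \<longleftrightarrow>
     (\<exists>p t. lion_strategy G k p \<and> (\<forall>i<k. p i t = q i) \<and> contaminated G k p t \<inter> X = {})"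

lemma contaminated_subset: "contaminated G k p t \<subseteq> pverts G - lion_positions k p t"
  by (induction t) auto

lemma contaminated_cong:
  "(\<And>i s. i < k \<Longrightarrow> s \<le> t \<Longrightarrow> p i s = p' i s) \<Longrightarrow> contaminated G k p t = contaminated G k p' t"
proof (induction t)
  case 0
  then have "lion_positions k p 0 = lion_positions k p' 0"
    unfolding lion_positions_def by (intro Collect_cong ex_cong1) auto
  then show ?case by simp
next
  case (Suc t)
  have "lion_positions k p (Suc t) = lion_positions k p' (Suc t)"
    "lion_moves k p (Suc t) = lion_moves k p' (Suc t)"
    unfolding lion_positions_def lion_moves_def
    by (intro Collect_cong ex_cong1; use Suc.prems in auto)+
  moreover have "contaminated G k p t = contaminated G k p' t" using Suc by simp
  ultimately show ?case by simp
qed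

lemma lion_positions_image:
  assumes "\<And>i. i < k \<Longrightarrow> p i t = q i"
  shows "lion_positions k p t = q ` {..<k}"
proof -
  have "lion_positions k p t = (\<lambda>i. p i t) ` {..<k}" by (auto simp: lion_positions_def)
  also have "\<dots> = q ` {..<k}" using assms by (intro image_cong) auto
  finally show ?thesis .
qed

lemma can_clear_occupied:
  assumes "can_clear G k q X"
  shows "can_clear G k q (X \<union> q ` {..<k})"
proof -
  obtain p t where pt: "lion_strategy G k p" "\<forall>i<k. p i t = q i" "contaminated G k p t \<inter> X = {}"
    using assms by (auto simp: can_clear_def)
  moreover have "contaminated G k p t \<inter> q ` {..<k} = {}"
    using contaminated_subset[of G k p t] lion_positions_image[of k p t q] pt(2) by auto
  ultimately show ?thesis unfolding can_clear_def by blast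
qed

lemma can_clear_subset: "can_clear G k q X \<Longrightarrow> Y \<subseteq> X \<Longrightarrow> can_clear G k q Y"
  unfolding can_clear_def by blast

text \<open>Contamination could enter \<open>X\<close> only at a vertex with a neighbour outside,
  and all these are occupied after the move.\<close>

lemma can_clear_step:
  assumes "can_clear G k q X"
    and moves: "\<And>i. i < k \<Longrightarrow> q' i = q i \<or> (q i, q' i) \<in> parcs G"
    and guard: "\<And>v w. v \<in> X \<Longrightarrow> w \<notin> X \<Longrightarrow> (v, w) \<in> parcs G \<Longrightarrow> v \<in> q' ` {..<k}"
  shows "can_clear G k q' X"
proof -
  obtain p t where p: "lion_strategy G k p" and pt: "\<forall>i<k. p i t = q i"
    and X: "contaminated G k p t \<inter> X = {}"
    using assms(1) by (auto simp: can_clear_def)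
  \<comment> \<open>After time \<open>t\<close> all lions go to \<open>q'\<close> in one step and
    stay there forever, which is again a legal strategy.\<close>
  define p' where "p' i s = (if s \<le> t then p i s else q' i)" for i s
  have "p' i s \<in> {p' i (s - 1)} \<union> neighbours G (p' i (s - 1))" if "i < k" "1 \<le> s" for i s
  proof -
    consider "s \<le> t" | "s = Suc t" | "s > Suc t" by linarith
    then show ?thesis
    proof cases
      case 1
      then show ?thesis using p that by (auto simp: p'_def lion_strategy_def)
    next
      case 2
      then show ?thesis using pt moves[of i] that by (auto simp: p'_def neighbours_def)
    next
      case 3
      then show ?thesis by (auto simp: p'_def)
    qed
  qed
  then have strategy: "lion_strategy G k p'" using p by (auto simp: lion_strategy_def p'_def)
  have "contaminated G k p' t = contaminated G k p t"
    by (rule contaminated_cong) (auto simp: p'_def)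
  moreover have "lion_positions k p' (Suc t) = q' ` {..<k}"
    by (rule lion_positions_image) (simp add: p'_def)
  ultimately have "contaminated G k p' (Suc t) \<inter> X = {}"
    using X guard by (simp add: neighbours_def) blast
  moreover have "\<forall>i<k. p' i (Suc t) = q' i" by (auto simp: p'_def)
  ultimately show ?thesis using strategy unfolding can_clear_def by blast
qed

lemma can_clear_move_lion:
  assumes "can_clear G k q X" "i < k" "(q i, u) \<in> (parcs G)\<^sup>*"
    and guard: "\<And>v w. v \<in> X \<Longrightarrow> w \<notin> X \<Longrightarrow> (v, w) \<in> parcs G \<Longrightarrow> v \<in> q ` ({..<k} - {i})"
  shows "can_clear G k (q(i := u)) X"
  using assms(3)
proof induction
  case base
  then show ?case using assms(1) by simp
next
  case (step y z)
  show ?case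
  proof (rule can_clear_step[OF step.IH])
    fix v w assume "v \<in> X" "w \<notin> X" "(v, w) \<in> parcs G"
    then show "v \<in> (q(i := z)) ` {..<k}" using guard[of v w] by (auto simp: image_iff)
  qed (use step in auto)
qed

text \<open>The lions walk one after the other while those in \<open>J\<close> stand still and guard
  \<open>X\<close>. Only values below \<open>k\<close> matter, hence the separate
  \<open>q''\<close>.\<close>

lemma can_clear_move_lions:
  assumes "can_clear G k q X" "\<And>i. i < k \<Longrightarrow> (q i, q' i) \<in> (parcs G)\<^sup>*"
    and J: "J \<subseteq> {..<k}" "\<And>j. j \<in> J \<Longrightarrow> q' j = q j"
    and guard: "\<And>v w. v \<in> X \<Longrightarrow> w \<notin> X \<Longrightarrow> (v, w) \<in> parcs G \<Longrightarrow> v \<in> q ` J"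
  shows "\<exists>q''. (\<forall>i<k. q'' i = q' i) \<and> can_clear G k q'' X"
proof -
  have "can_clear G k (\<lambda>i. if i < n then q' i else q i) X" if "n \<le> k" for n
    using that
  proof (induction n)
    case 0
    then show ?case using assms(1) by simp
  next
    case (Suc n)
    let ?q = "\<lambda>i. if i < n then q' i else q i"
    have *: "(\<lambda>i. if i < Suc n then q' i else q i) = ?q(n := q' n)" by (auto simp: less_Suc_eq)
    show ?case
    proof (cases "n \<in> J")
      case True
      then have "?q(n := q' n) = ?q" using J by auto
      then show ?thesis using Suc * by simp
    next
      case False
      have "can_clear G k (?q(n := q' n)) X"
      proof (rule can_clear_move_lion)
        fix v w assume "v \<in> X" "w \<notin> X" "(v, w) \<in> parcs G"
        then obtain j where "j \<in> J" "v = q j" using guard by blast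
        then show "v \<in> ?q ` ({..<k} - {n})" using J False by (intro image_eqI[of _ _ j]) auto
      next
        show "can_clear G k ?q X" "n < k" using Suc by simp_all
        then show "(?q n, q' n) \<in> (parcs G)\<^sup>*" using assms(2)[of n] by simp
      qed
      then show ?thesis using * by simp
    qed
  qed
  then show ?thesis by (intro exI[of _ "\<lambda>i. if i < k then q' i else q i"]) auto
qed

text \<open>One lion is kept on each vertex of \<open>g\<close>. By counting, enough others remain
  to be sent injectively to the rest of \<open>B\<close>; those left over do not move.\<close>

lemma reassign_lions:
  fixes q :: "nat \<Rightarrow> 'a"
  assumes "g \<subseteq> q ` {..<k}" "g \<subseteq> B" "finite B" "card B \<le> k"
  obtains q' J where "J \<subseteq> {..<k}" "g \<subseteq> q ` J" "\<And>j. j \<in> J \<Longrightarrow> q' j = q j" "B \<subseteq> q' ` {..<k}"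
    "\<And>i. q' i \<in> insert (q i) B"
proof -
  obtain J where J: "J \<subseteq> {..<k}" "inj_on q J" "g = q ` J"
    using assms(1)[unfolded subset_image_inj] by blast
  have fin: "finite J" "finite (B - g)" "finite g"
    using finite_subset[OF J(1)] assms finite_subset[OF assms(2)] by auto
  have "card J = card g" using J card_image by fastforce
  then have "card (B - g) \<le> card ({..<k} - J)"
    using assms J(1) fin by (simp add: card_Diff_subset)
  then obtain f where f: "f ` (B - g) \<subseteq> {..<k} - J" "inj_on f (B - g)"
    using card_le_inj[of "B - g" "{..<k} - J"] fin by auto
  define q' where "q' i = (if i \<in> f ` (B - g) then the_inv_into (B - g) f i else q i)" for i
  have inv: "q' (f b) = b" if "b \<in> B - g" for b
    using that f by (auto simp: q'_def the_inv_into_f_f)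
  show ?thesis
  proof
    show "J \<subseteq> {..<k}" "g \<subseteq> q ` J" using J by auto
    show "q' j = q j" if "j \<in> J" for j using that f by (auto simp: q'_def)
    then have "g \<subseteq> q' ` {..<k}" using J by force
    moreover have "B - g \<subseteq> q' ` {..<k}" using inv f by (force simp: image_iff)
    ultimately show "B \<subseteq> q' ` {..<k}" by blast
    show "q' i \<in> insert (q i) B" for i
      using inv by (cases "i \<in> f ` (B - g)") (auto simp: q'_def)
  qed
qed

lemma lion_number_le_bag_size:
  assumes fin: "finite (pverts G)" and ne: "pverts G \<noteq> {}"
    and reach: "\<And>u v. u \<in> pverts G \<Longrightarrow> v \<in> pverts G \<Longrightarrow> (u, v) \<in> (parcs G)\<^sup>*"
    and pd: "path_decomposition G Bs" and k: "1 \<le> k" "\<And>B. B \<in> set Bs \<Longrightarrow> card B \<le> k"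
  shows "lion_number G \<le> k"
proof -
  have bags: "B \<subseteq> pverts G" if "B \<in> set Bs" for B using pd that by (auto simp: path_decomposition_def)
  have interval: "v \<in> Bs ! j" if "i \<le> j" "j \<le> l" "l < length Bs" "v \<in> Bs ! i" "v \<in> Bs ! l" for v i j l
  proof -
    have "v \<in> pverts G" using bags[of "Bs ! i"] that by auto
    then show ?thesis using pd that unfolding path_decomposition_def by blast
  qed
  obtain v0 where v0: "v0 \<in> pverts G" using ne by blast
  \<comment> \<open>Sweep invariant: the first \<open>n\<close> bags are clear and the last of them
    is occupied. For \<open>n = 0\<close> all lions wait at \<open>v0\<close> and nothing is claimed
    clear.\<close>
  have "\<exists>q. can_clear G k q (\<Union> (set (take n Bs))) \<and> (\<forall>i<k. q i \<in> pverts G) \<and>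
      (0 < n \<longrightarrow> Bs ! (n - 1) \<subseteq> q ` {..<k})"
    if "n \<le> length Bs" for n
    using that
  proof (induction n)
    case 0
    have "lion_strategy G k (\<lambda>i t. v0)" using k v0 by (auto simp: lion_strategy_def)
    then have "can_clear G k (\<lambda>i. v0) {}" unfolding can_clear_def by blast
    then show ?case using v0 by auto
  next
    case (Suc n)
    let ?X = "\<Union> (set (take n Bs))" and ?B = "Bs ! n"
    obtain q where q: "can_clear G k q ?X" "\<forall>i<k. q i \<in> pverts G" "0 < n \<longrightarrow> Bs ! (n - 1) \<subseteq> q ` {..<k}"
      using Suc by auto
    have BB: "?B \<in> set Bs" using Suc.prems by simp
    \<comment> \<open>The case \<open>n = 0\<close> is separate because \<open>n - 1\<close> would
      then denote bag 0, which is not occupied yet.\<close>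
    define g where "g = (if n = 0 then {} else Bs ! (n - 1)) \<inter> ?B"
    \<comment> \<open>A cleared vertex with an uncleared neighbour shares with it a bag of index at
      least \<open>n\<close>, so its interval contains both \<open>n - 1\<close> and
      \<open>n\<close>.\<close>
    have boundary: "v \<in> g" if vw: "v \<in> ?X" "w \<notin> ?X" "(v, w) \<in> parcs G" for v w
    proof -
      obtain i where i: "i < n" "v \<in> Bs ! i"
        using vw(1) Suc.prems by (auto simp: in_set_conv_nth)
      have "\<forall>(u, v)\<in>parcs G. \<exists>B\<in>set Bs. u \<in> B \<and> v \<in> B"
        using pd by (simp add: path_decomposition_def)
      then obtain B where "B \<in> set Bs" "v \<in> B" "w \<in> B" using vw(3) by blast
      then obtain l where l: "l < length Bs" "v \<in> Bs ! l" "w \<in> Bs ! l" by (auto simp: in_set_conv_nth)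
      have "\<not> l < n"
      proof
        assume "l < n"
        then have "Bs ! l \<in> set (take n Bs)" using l by (auto simp: in_set_conv_nth)
        then show False using l vw(2) by auto
      qed
      then show ?thesis using i l interval[of i "n - 1" l v] interval[of i n l v] by (auto simp: g_def)
    qed
    have "g \<subseteq> q ` {..<k}" "g \<subseteq> ?B" using q(3) by (auto simp: g_def)
    moreover have "finite ?B" using bags[OF BB] fin finite_subset by blast
    ultimately obtain q' J where J: "J \<subseteq> {..<k}" "g \<subseteq> q ` J" "\<And>j. j \<in> J \<Longrightarrow> q' j = q j"
      and q': "?B \<subseteq> q' ` {..<k}" "\<And>i. q' i \<in> insert (q i) ?B"
      using reassign_lions[of g q k ?B] k(2)[OF BB] by metis
    have q'V: "q' i \<in> pverts G" if "i < k" for i using q'(2)[of i] q(2) bags[OF BB] that by auto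
    have "\<exists>q''. (\<forall>i<k. q'' i = q' i) \<and> can_clear G k q'' ?X"
    proof (rule can_clear_move_lions[OF q(1)])
      show "(q i, q' i) \<in> (parcs G)\<^sup>*" if "i < k" for i using reach q'V q(2) that by blast
      show "v \<in> q ` J" if "v \<in> ?X" "w \<notin> ?X" "(v, w) \<in> parcs G" for v w
        using boundary[OF that] J(2) by blast
    qed (use J in auto)
    then obtain q'' where q'': "\<forall>i<k. q'' i = q' i" "can_clear G k q'' ?X" by blast
    have "q'' ` {..<k} = q' ` {..<k}" using q''(1) by (intro image_cong) auto
    then have "?B \<subseteq> q'' ` {..<k}" using q'(1) by simp
    moreover have "can_clear G k q'' (\<Union> (set (take (Suc n) Bs)))"
    proof (rule can_clear_subset[OF can_clear_occupied[OF q''(2)]])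
      show "\<Union> (set (take (Suc n) Bs)) \<subseteq> ?X \<union> q'' ` {..<k}"
        using Suc.prems \<open>?B \<subseteq> q'' ` {..<k}\<close> by (auto simp: take_Suc_conv_app_nth)
    qed
    moreover have "\<forall>i<k. q'' i \<in> pverts G" using q''(1) q'V by simp
    ultimately show ?case by (intro exI[of _ q'']) simp
  qed
  from this[of "length Bs"] obtain q where "can_clear G k q (pverts G)"
    using pd by (auto simp: path_decomposition_def)
  then obtain p t where "lion_strategy G k p" "contaminated G k p t \<inter> pverts G = {}"
    unfolding can_clear_def by blast
  then have "lion_strategy G k p \<and> clears G k p"
    using contaminated_subset[of G k p t] unfolding clears_def by blast
  then show ?thesis unfolding lion_number_def by (intro Least_le) blast
qed

section \<open>Trees\<close>

lemma undirected_tree_reachable: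
  assumes "undirected_tree T" "u \<in> pverts T" "v \<in> pverts T"
  shows "(u, v) \<in> (parcs T)\<^sup>*"
proof -
  interpret pair_graph T using assms by (simp add: undirected_tree_def)
  have "strongly_connected (with_proj T)"
    using symmetric_connected_imp_strongly_connected pair_sym_arcs assms(1)
    by (auto simp: undirected_tree_def)
  then have "u \<rightarrow>\<^sup>*\<^bsub>with_proj T\<^esub> v" using assms by (auto simp: strongly_connected_def)
  then show ?thesis unfolding reachable_def by (auto dest: rtrancl_on_rtranclI)
qed

text \<open>If the ends of an edge stayed connected without it, a path between them would close with
  the edge to a cycle.\<close>

lemma undirected_tree_acyclic_edges:
  assumes "undirected_tree T"
  shows "acyclic_edges (parcs T)"
proof
  interpret pair_graph T using assms by (simp add: undirected_tree_def)
  show "sym (parcs T)" using pair_sym_arcs by (simp add: symmetric_def)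
  fix u w assume uw: "(u, w) \<in> parcs T"
  define R where "R = parcs T - {(u, w), (w, u)}"
  define H where "H = T\<lparr>parcs := R\<rparr>"
  have H: "pverts H = pverts T" "parcs H = R" by (simp_all add: H_def)
  interpret H: pair_wf_digraph H
    by unfold_locales (auto simp: H R_def dest: in_arcsD1 in_arcsD2)
  have V: "u \<in> pverts T" "w \<in> pverts T" using uw by (auto dest: in_arcsD1 in_arcsD2)
  show "(w, u) \<notin> (parcs T - {(u, w), (w, u)})\<^sup>*"
  proof
    assume "(w, u) \<in> (parcs T - {(u, w), (w, u)})\<^sup>*"
    then have "(w, u) \<in> R\<^sup>*" by (simp add: R_def)
    then have "w \<rightarrow>\<^sup>*\<^bsub>with_proj H\<^esub> u"
    proof induction
      case base
      then show ?case using V H by auto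
    next
      case (step y z)
      then show ?case using H.reachable_adj_trans[of w y z] H by auto
    qed
    then obtain c where c: "H.apath w c u" using H.reachable_apath by blast
    then have c': "set c \<subseteq> R" "pcas w c u" "distinct (pawalk_verts w c)"
      by (auto simp: H.apath_def H.awalk_def H cas_with_proj_eq awalk_verts_with_proj_eq)
    have "awalk u ((u, w) # c) u"
      using c' uw V by (auto simp: awalk_def R_def cas_with_proj_eq)
    moreover have "distinct (tl (awalk_verts u ((u, w) # c)))"
      using c' by (simp add: awalk_verts_with_proj_eq)
    ultimately have "cycle ((u, w) # c)" unfolding cycle_def by blast
    moreover have "c \<noteq> []" using c'(2) pair_no_loops[OF uw] by auto
    \<comment> \<open>A single arc from \<open>w\<close> to \<open>u\<close> would be the removed
      one, so the cycle has length at least 3.\<close>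
    moreover have "length c \<noteq> 1" using c' by (auto simp: R_def length_Suc_conv)
    ultimately have "cycle ((u, w) # c) \<and> 3 \<le> length ((u, w) # c)"
      by (cases c rule: list.exhaust) (auto simp: Suc_le_eq)
    then show False using assms unfolding undirected_tree_def by blast
  qed
qed

text \<open>Contamination travels with \<open>x\<close>: no lion occupies the next vertex or uses
  the edge, which is what its spreading requires.\<close>

lemma (in acyclic_edges) evader_contaminated:
  assumes "evader (pverts G) k p 0 b x" "E = parcs G" "t \<le> b"
  shows "x t \<in> contaminated G k p t"
  using assms(3)
proof (induction t)
  case 0
  have "x 0 \<in> pverts G" "\<forall>i<k. p i 0 \<noteq> x 0" using assms(1) by (auto simp: evader_def)
  then show ?case by (force simp: lion_positions_def)
next
  case (Suc t)
  have *: "x t \<in> contaminated G k p t" using Suc by simp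
  have x: "x (Suc t) \<in> pverts G" "\<forall>i<k. p i (Suc t) \<noteq> x (Suc t)" "\<forall>i<k. p i t \<noteq> x t"
    "x (Suc t) = x t \<or> (x t, x (Suc t)) \<in> E" "\<forall>i<k. \<not> (p i t = x (Suc t) \<and> p i (Suc t) = x t)"
    using assms(1) Suc.prems by (auto simp: evader_def)
  have nl: "x (Suc t) \<notin> lion_positions k p (Suc t)" using x(2) by (force simp: lion_positions_def)
  show ?case
  proof (cases "x (Suc t) = x t")
    case True
    then show ?thesis using * nl by simp
  next
    case False
    then have "x t \<in> neighbours G (x (Suc t))"
      using x(4) edge_sym by (auto simp: neighbours_def assms(2)[symmetric])
    moreover have "(x (Suc t), x t) \<notin> lion_moves k p (Suc t)" "(x t, x (Suc t)) \<notin> lion_moves k p (Suc t)"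
      using x(3,5) by (force simp: lion_moves_def)+
    ultimately show ?thesis using * nl x(1) by auto
  qed
qed

theorem theorem14:
  fixes T :: "'a pair_pre_digraph"
  assumes "undirected_tree T"
  shows "pathwidth T \<le> lion_number T \<and> lion_number T \<le> pathwidth T + 1"
proof
  have graph: "pair_graph T" using assms by (simp add: undirected_tree_def)
  interpret pair_graph T by (rule graph)
  interpret A: acyclic_edges "parcs T" by (rule undirected_tree_acyclic_edges[OF assms])
  have ne: "pverts T \<noteq> {}"
    using assms by (auto simp: undirected_tree_def connected_def strongly_connected_def mk_symmetric_def)
  have wf: "parcs T \<subseteq> pverts T \<times> pverts T" by (auto dest: in_arcsD1 in_arcsD2)
  note reach = undirected_tree_reachable[OF assms]
  show "lion_number T \<le> pathwidth T + 1"
  proof -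
    obtain Bs where Bs: "path_decomposition T Bs" "width Bs = pathwidth T"
      using pathwidth_attained[OF graph] by blast
    have "card B \<le> pathwidth T + 1" if "B \<in> set Bs" for B
    proof -
      have "card B \<le> Max (card ` set Bs)" using that by auto
      then show ?thesis using Bs(2) by (auto simp: width_def)
    qed
    then show ?thesis using lion_number_le_bag_size[OF pair_finite_verts ne reach Bs(1)] by auto
  qed
  show "pathwidth T \<le> lion_number T"
  proof (rule ccontr)
    assume less: "\<not> ?thesis"
    define k where "k = lion_number T"
    obtain p where p: "lion_strategy T k p" "clears T k p"
      using lion_number_attained[OF graph ne] by (auto simp: k_def)
    \<comment> \<open>Bags of size at most \<open>Suc k\<close> would give width at most
      \<open>k\<close>, below the assumed pathwidth.\<close>
    have "\<not> A.has_pd (pverts T) (Suc k)"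
    proof
      assume "A.has_pd (pverts T) (Suc k)"
      then obtain Bs where Bs: "A.pd (pverts T) (Suc k) Bs" by (auto simp: A.has_pd_def)
      have "path_decomposition T Bs"
        using A.pd_Union[OF Bs] A.pd_edge[OF Bs] A.pd_interval[OF Bs] wf
        unfolding path_decomposition_def by (auto 0 4)
      then have "pathwidth T \<le> width Bs" unfolding pathwidth_def by (intro Least_le) blast
      also have "Max (card ` set Bs) \<le> Suc k"
        using A.pd_card[OF Bs] A.pd_nonempty[OF Bs] by auto
      then have "width Bs \<le> k" by (auto simp: width_def)
      finally show False using less by (simp add: k_def)
    qed
    moreover have "A.conn (pverts T)"
      using reach ne wf by (auto simp: A.conn_def Int_absorb2)
    ultimately have ev: "A.evade (pverts T) k" using A.evade_if_no_pd pair_finite_verts by blast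
    obtain b where b: "contaminated T k p b = {}" using p(2) by (auto simp: clears_def)
    have step: "p i (Suc t) = p i t \<or> (p i t, p i (Suc t)) \<in> parcs T" if "i < k" for i t
    proof -
      have "p i (Suc t) \<in> {p i (Suc t - 1)} \<union> neighbours T (p i (Suc t - 1))"
        using p(1) that unfolding lion_strategy_def by (metis le_add1 plus_1_eq_Suc)
      then show ?thesis by (simp add: neighbours_def)
    qed
    have "p i t \<in> pverts T" if "i < k" for i t
    proof (induction t)
      case 0
      then show ?case using p(1) that by (simp add: lion_strategy_def)
    next
      case (Suc t)
      then show ?case using step[OF that, of t] wf by auto
    qed
    then have "A.lions (pverts T) k p 0 b" using step by (auto simp: A.lions_def)
    then obtain x where "A.evader (pverts T) k p 0 b x" using ev unfolding A.evade_def by blast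
    then have "x b \<in> contaminated T k p b" by (intro A.evader_contaminated) auto
    then show False using b by simp
  qed
qed

end
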